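(* As $n \to \infty$, $$s(n) = \sqrt{2n} + \frac{1}{6}\log n + O(1),$$ i.e. there is a constant $C<\infty$ such that $\left| s(n) - \sqrt{2n} - \frac16 \log n\right| \le C$ for all integers $n \ge 1$, where $s(n)$ is the optimal expected length of an increasing subsequence selected sequentially from a uniformly random permutation of $\{1,\dots,n\}$.
   Context: Here $\log$ is the natural logarithm. Let $\pi$ be a uniformly distributed random permutation of $\{1,\dots,n\}$, and let $\mathcal{F}_k = \sigma\{\pi[1],\dots,\pi[k]\}$ for $1\le k\le n$. A feasible selection strategy $\boldsymbol{\tau}$ is a sequence $\tau_1<\tau_2<\cdots$ of stopping times with respect to $(\mathcal{F}_k)_{1\le k\le n}$ (with values in $\{1,\dots,n\}\cup\{\infty\}$, strictly increasing as long as they are finite; $\tau_j=\infty$ means no $j$-th selection is made). For such a strategy put $$L^{\boldsymbol{\tau}}_n=\max\{k: \pi[\tau_1] < \pi[\tau_2]< \cdots < \pi[\tau_k], \ 1\leq \tau_1< \tau_2 <\cdots < \tau_k \leq n \}$$ (with value $0$ if no selection is made), and define $$s(n) = \sup_{\boldsymbol{\tau}} \mathbb{E}[L^{\boldsymbol{\tau}}_n],$$ the supremum being over all feasible selection strategies. *)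

theory Defs
  imports "HOL-Probability.Probability" "HOL-Combinatorics.Permutations"
begin

definition perms :: "nat \<Rightarrow> (nat \<Rightarrow> nat) set" where
  "perms n = {\<pi>. \<pi> permutes {1..n}}"

text \<open>The \<sigma>-algebra generated by \<open>\<pi>[1], \<dots>, \<pi>[k]\<close>. Since stopping times may be infinite, the time
  index ranges over \<^typ>\<open>enat\<close>: this adds the trivial \<sigma>-algebra at time \<open>0\<close> and repeats the full
  one at every time beyond \<open>n\<close>. The lemma \<open>stopping_time_perm_filtration_iff\<close> below shows that these
  additional times do not affect the notion of a stopping time.\<close>

definition perm_filtration :: "nat \<Rightarrow> enat \<Rightarrow> (nat \<Rightarrow> nat) measure" where
  "perm_filtration n k =
     sigma (perms n) {{\<pi> \<in> perms n. \<pi> i = v} | i v. i \<in> {1..n} \<and> enat i \<le> k}"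

text \<open>Selections are numbered from \<open>1\<close>; the value of a strategy at index \<open>0\<close> is irrelevant.\<close>

definition feasible_strategy :: "nat \<Rightarrow> (nat \<Rightarrow> (nat \<Rightarrow> nat) \<Rightarrow> enat) \<Rightarrow> bool" where
  "feasible_strategy n \<tau> \<longleftrightarrow>
     (\<forall>j\<ge>1. stopping_time (perm_filtration n) (\<tau> j)) \<and>
     (\<forall>j\<ge>1. \<forall>\<pi>\<in>perms n. \<tau> j \<pi> \<in> enat ` {1..n} \<union> {\<infinity>}) \<and>
     (\<forall>j\<ge>1. \<forall>\<pi>\<in>perms n. \<tau> j \<pi> < \<tau> (Suc j) \<pi> \<or> (\<tau> j \<pi> = \<infinity> \<and> \<tau> (Suc j) \<pi> = \<infinity>))"

text \<open>The number \<open>k = 0\<close> always belongs to the set below, so the length is \<open>0\<close> if nothing is selected.\<close>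

definition selected_length ::
    "nat \<Rightarrow> (nat \<Rightarrow> (nat \<Rightarrow> nat) \<Rightarrow> enat) \<Rightarrow> (nat \<Rightarrow> nat) \<Rightarrow> nat" where
  "selected_length n \<tau> \<pi> =
     Max {k. (\<forall>j\<in>{1..k}. 1 \<le> \<tau> j \<pi> \<and> \<tau> j \<pi> \<le> enat n) \<and>
             (\<forall>j\<in>{1..<k}. \<tau> j \<pi> < \<tau> (Suc j) \<pi> \<and>
                \<pi> (the_enat (\<tau> j \<pi>)) < \<pi> (the_enat (\<tau> (Suc j) \<pi>)))}"

definition optimal_mean_length :: "nat \<Rightarrow> real" where
  "optimal_mean_length n =
     (SUP \<tau>\<in>Collect (feasible_strategy n).
        \<integral>\<pi>. real (selected_length n \<tau> \<pi>) \<partial>uniform_count_measure (perms n))"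


lemma space_perm_filtration [simp]: "space (perm_filtration n k) = perms n"
  unfolding perm_filtration_def by (rule space_measure_of) auto

lemma sets_perm_filtration:
  "sets (perm_filtration n k) =
     sigma_sets (perms n) {{\<pi> \<in> perms n. \<pi> i = v} | i v. i \<in> {1..n} \<and> enat i \<le> k}"
  unfolding perm_filtration_def by (rule sets_measure_of) auto

lemma filtration_perm_filtration: "filtration (perms n) (perm_filtration n)"
proof
  fix i j :: enat assume "i \<le> j"
  then show "sets (perm_filtration n i) \<le> sets (perm_filtration n j)"
    by (subst (1 2) sets_perm_filtration, intro sigma_sets_mono')
       (use order_trans in blast)
qed simp

lemma stopping_time_perm_filtration_iff:
  assumes "\<And>\<pi>. \<pi> \<in> perms n \<Longrightarrow> T \<pi> \<in> enat ` {1..n} \<union> {\<infinity>}"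
  shows "stopping_time (perm_filtration n) T \<longleftrightarrow>
    (\<forall>k\<in>{1..n}. {\<pi> \<in> perms n. T \<pi> \<le> enat k} \<in> sets (perm_filtration n (enat k)))"
proof
  assume R: "\<forall>k\<in>{1..n}. {\<pi> \<in> perms n. T \<pi> \<le> enat k} \<in> sets (perm_filtration n (enat k))"
  show "stopping_time (perm_filtration n) T"
    unfolding stopping_time_def pred_def space_perm_filtration
  proof
    fix t :: enat
    have empty: "{\<pi> \<in> perms n. T \<pi> \<le> 0} = {}"
      by (auto simp: zero_enat_def dest!: assms)
    consider "t = \<infinity>" | "t = 0" | k where "t = enat k" "k \<in> {1..n}" | k where "t = enat k" "k > n"
    proof (cases t)
      case (enat m)
      then show thesis
        using that(2-4) by (cases "m = 0"; cases "m \<le> n") (auto simp: zero_enat_def)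
    qed (use that in simp)
    then show "{\<pi> \<in> perms n. T \<pi> \<le> t} \<in> sets (perm_filtration n t)"
    proof cases
      case 1
      then show ?thesis using sets.top[of "perm_filtration n t"] by simp
    next
      case 2
      show ?thesis unfolding 2 empty by (rule sets.empty_sets)
    next
      case 3
      then show ?thesis using R by simp
    next
      case 4
      have eq: "{\<pi> \<in> perms n. T \<pi> \<le> t} = {\<pi> \<in> perms n. T \<pi> \<le> enat n}"
      proof (rule Collect_cong, rule conj_cong[OF refl])
        fix \<pi> assume "\<pi> \<in> perms n"
        from assms[OF this] show "T \<pi> \<le> t \<longleftrightarrow> T \<pi> \<le> enat n" using 4 by auto
      qed
      have "{\<pi> \<in> perms n. T \<pi> \<le> enat n} \<in> sets (perm_filtration n (enat n))"
      proof (cases "n = 0")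
        case True
        show ?thesis
          unfolding True zero_enat_def[symmetric] using empty[unfolded True]
          by (metis sets.empty_sets)
      qed (use R in simp)
      moreover have "sets (perm_filtration n (enat n)) \<le> sets (perm_filtration n t)"
        using filtration.sets_F_mono[OF filtration_perm_filtration] 4 by simp
      ultimately show ?thesis using eq by auto
    qed
  qed
qed (auto simp: stopping_time_def pred_def)

text \<open>The maximum in \<^const>\<open>selected_length\<close> and the supremum in \<^const>\<open>optimal_mean_length\<close> are
  taken over a finite set and over a nonempty bounded set of reals, respectively.\<close>

lemma selected_length_chain_le:
  assumes "\<forall>j\<in>{1..k}. 1 \<le> \<tau> j \<pi> \<and> \<tau> j \<pi> \<le> enat n" "\<forall>j\<in>{1..<k}. \<tau> j \<pi> < \<tau> (Suc j) \<pi>"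
  shows "k \<le> n"
proof -
  have "enat j \<le> \<tau> j \<pi>" if "1 \<le> j" "j \<le> k" for j
    using that
  proof (induction j rule: dec_induct)
    case base
    then show ?case using assms(1) by (simp add: one_enat_def)
  next
    case (step j)
    then have "enat j \<le> \<tau> j \<pi>" "\<tau> j \<pi> < \<tau> (Suc j) \<pi>" using assms(2) by auto
    then have "enat j < \<tau> (Suc j) \<pi>" by (rule order.strict_trans1)
    then show ?case by (simp add: Suc_ile_eq)
  qed
  note ge = this
  show ?thesis
  proof (cases "k = 0")
    case False
    then have "enat k \<le> \<tau> k \<pi>" "\<tau> k \<pi> \<le> enat n" using ge assms(1) by auto
    then have "enat k \<le> enat n" by (rule order_trans)
    then show ?thesis by simp
  qed simp
qed

lemma selected_length_finite:
  "finite {k. (\<forall>j\<in>{1..k}. 1 \<le> \<tau> j \<pi> \<and> \<tau> j \<pi> \<le> enat n) \<and>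
     (\<forall>j\<in>{1..<k}. \<tau> j \<pi> < \<tau> (Suc j) \<pi> \<and>
        \<pi> (the_enat (\<tau> j \<pi>)) < \<pi> (the_enat (\<tau> (Suc j) \<pi>)))}" (is "finite ?K")
proof (rule finite_subset)
  show "?K \<subseteq> {..n}"
    using selected_length_chain_le[where \<tau> = \<tau> and \<pi> = \<pi> and n = n] by blast
qed simp

lemma selected_length_le: "selected_length n \<tau> \<pi> \<le> n"
  unfolding selected_length_def
proof (rule Max.boundedI[OF selected_length_finite], goal_cases)
  case 1
  have "0 \<in> {k. (\<forall>j\<in>{1..k}. 1 \<le> \<tau> j \<pi> \<and> \<tau> j \<pi> \<le> enat n) \<and>
    (\<forall>j\<in>{1..<k}. \<tau> j \<pi> < \<tau> (Suc j) \<pi> \<and>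
       \<pi> (the_enat (\<tau> j \<pi>)) < \<pi> (the_enat (\<tau> (Suc j) \<pi>)))}" by simp
  then show ?case by blast
next
  case (2 k)
  then show ?case
    by (intro selected_length_chain_le[where \<tau> = \<tau> and \<pi> = \<pi>]) auto
qed

lemma finite_perms: "finite (perms n)"
  unfolding perms_def by (rule finite_permutations) simp

lemma perms_nonempty: "perms n \<noteq> {}"
  unfolding perms_def using permutes_id by blast

lemma feasible_strategy_never: "feasible_strategy n (\<lambda>_ _. \<infinity>)"
  by (simp add: feasible_strategy_def stopping_time_const)

lemma bdd_above_mean_length:
  "bdd_above ((\<lambda>\<tau>. \<integral>\<pi>. real (selected_length n \<tau> \<pi>) \<partial>uniform_count_measure (perms n)) `
     Collect (feasible_strategy n))"
proof (rule bdd_aboveI2)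
  fix \<tau> :: "nat \<Rightarrow> (nat \<Rightarrow> nat) \<Rightarrow> enat"
  interpret prob_space "uniform_count_measure (perms n)"
    using finite_perms perms_nonempty by (rule prob_space_uniform_count_measure)
  show "(\<integral>\<pi>. real (selected_length n \<tau> \<pi>) \<partial>uniform_count_measure (perms n)) \<le> real n"
    by (rule integral_le_const)
       (auto simp: selected_length_le finite_perms uniform_count_measure_def
          intro!: integrable_point_measure_finite)
qed

end

theory Submission
  imports Defs "HOL-Real_Asymp.Real_Asymp"
begin

text \<open>Only the remaining values above the last selected one matter, and their relative order is again
  uniform. Hence the optimal mean length satisfies the dynamic programming recursion
  \<open>v (n + 1) = (\<Sum>i\<le>n. max (v n) (1 + v i)) / (n + 1)\<close> with \<open>v 0 = 0\<close>: the current length plus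
  \<open>v\<close> of the number of useful remaining values is a supermartingale under every strategy, and a
  martingale under the greedy one. The recursion is monotone and commutes with adding constants, so
  comparison with functions of the form \<open>sqrt (2 * x) + ln x / 6 - c / sqrt (2 * x)\<close>, which are
  supersolutions for \<open>c = 10\<close> and subsolutions for \<open>c = -100\<close> at all large arguments, bounds \<open>v\<close>
  from both sides up to an additive constant.\<close>

subsection \<open>Comparison for the recursion\<close>

text \<open>The argument counts the unseen values above the last selected one. The next of these to
  appear has \<open>i\<close> of the others above it, with \<open>i\<close> uniform: refusing it
  leaves \<open>n\<close> useful values, accepting it leaves \<open>i\<close>.\<close>

fun bellman :: "nat \<Rightarrow> real" where
  "bellman 0 = 0"
| "bellman (Suc n) = (\<Sum>i\<le>n. max (bellman n) (1 + bellman i)) / real (Suc n)"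

text \<open>\<open>C\<close> is large enough for the bound to hold up to \<open>N\<close>; beyond,
  each step of the recursion reproduces it with the same \<open>C\<close>, since a constant passes
  through both \<open>max\<close> and the average.\<close>

lemma bellman_le_supersolution:
  assumes "\<And>n. n \<ge> N \<Longrightarrow> (\<Sum>i\<le>n. max (f n) (1 + f i)) \<le> real (Suc n) * f (Suc n)"
  shows "\<exists>C. \<forall>n. bellman n \<le> f n + C"
proof -
  define C where "C = (\<Sum>i\<le>N. \<bar>bellman i - f i\<bar>)"
  have "bellman n \<le> f n + C" for n
  proof (induction n rule: less_induct)
    case (less n)
    show ?case
    proof (cases "n \<le> N")
      case True
      then have "\<bar>bellman n - f n\<bar> \<le> C"
        unfolding C_def by (intro member_le_sum) auto
      then show ?thesis by linarith
    next
      case False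
      then obtain m where m: "n = Suc m" "m \<ge> N" by (cases n) auto
      have "(\<Sum>i\<le>m. max (bellman m) (1 + bellman i)) \<le> (\<Sum>i\<le>m. max (f m) (1 + f i) + C)"
      proof (intro sum_mono)
        fix i assume "i \<in> {..m}"
        then have "bellman i \<le> f i + C" "bellman m \<le> f m + C" using less m by auto
        then show "max (bellman m) (1 + bellman i) \<le> max (f m) (1 + f i) + C" by linarith
      qed
      also have "\<dots> = (\<Sum>i\<le>m. max (f m) (1 + f i)) + real (Suc m) * C"
        by (simp add: sum.distrib)
      also have "\<dots> \<le> real (Suc m) * (f n + C)"
        using assms[OF m(2)] m by (simp add: algebra_simps)
      finally show ?thesis unfolding m bellman.simps
        by (simp add: divide_le_eq mult.commute del: of_nat_Suc)
    qed
  qed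
  then show ?thesis by blast
qed

lemma bellman_ge_subsolution:
  assumes "\<And>n. n \<ge> N \<Longrightarrow> real (Suc n) * f (Suc n) \<le> (\<Sum>i\<le>n. max (f n) (1 + f i))"
  shows "\<exists>C. \<forall>n. f n - C \<le> bellman n"
proof -
  define C where "C = (\<Sum>i\<le>N. \<bar>bellman i - f i\<bar>)"
  have "f n - C \<le> bellman n" for n
  proof (induction n rule: less_induct)
    case (less n)
    show ?case
    proof (cases "n \<le> N")
      case True
      then have "\<bar>bellman n - f n\<bar> \<le> C"
        unfolding C_def by (intro member_le_sum) auto
      then show ?thesis by linarith
    next
      case False
      then obtain m where m: "n = Suc m" "m \<ge> N" by (cases n) auto
      have "real (Suc m) * (f n - C) \<le> (\<Sum>i\<le>m. max (f m) (1 + f i)) - real (Suc m) * C"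
        using assms[OF m(2)] m by (simp add: algebra_simps)
      also have "\<dots> = (\<Sum>i\<le>m. max (f m) (1 + f i) - C)"
        by (simp add: sum_subtractf)
      also have "\<dots> \<le> (\<Sum>i\<le>m. max (bellman m) (1 + bellman i))"
      proof (intro sum_mono)
        fix i assume "i \<in> {..m}"
        then have "f i - C \<le> bellman i" "f m - C \<le> bellman m" using less m by auto
        then show "max (f m) (1 + f i) - C \<le> max (bellman m) (1 + bellman i)" by linarith
      qed
      finally show ?thesis unfolding m bellman.simps
        by (simp add: le_divide_eq mult.commute del: of_nat_Suc)
    qed
  qed
  then show ?thesis by blast
qed

subsection \<open>Approximate solutions of the recursion\<close>

text \<open>The last term shifts the defect of the recursion by a multiple of \<open>c\<close> of the same order
  \<open>x powr (-3/2)\<close> as all other errors, so that its sign is that of \<open>c\<close> once \<open>\<bar>c\<bar>\<close> is large.\<close>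

definition profile :: "real \<Rightarrow> real \<Rightarrow> real" where
  "profile c x = sqrt (2 * x) + ln x / 6 - c / sqrt (2 * x)"
text \<open>Written in powers of \<open>sqrt (2 * x)\<close>, the variable in which all later
  expansions are made.\<close>

definition profile_d1 :: "real \<Rightarrow> real \<Rightarrow> real" where
  "profile_d1 c x = 1 / sqrt (2 * x) + 1 / (6 * x) + c / sqrt (2 * x) ^ 3"
definition profile_d2 :: "real \<Rightarrow> real \<Rightarrow> real" where
  "profile_d2 c x = - 1 / sqrt (2 * x) ^ 3 - 1 / (6 * x ^ 2) - 3 * c / sqrt (2 * x) ^ 5"
definition profile_d3 :: "real \<Rightarrow> real \<Rightarrow> real" where
  "profile_d3 c x = 3 / sqrt (2 * x) ^ 5 + 1 / (3 * x ^ 3) + 15 * c / sqrt (2 * x) ^ 7"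

section \<open>Derivatives and Taylor expansion of the profiles\<close>

lemma DERIV_inverse_sqrt_power:
  assumes "x > 0"
  shows "((\<lambda>x. c / sqrt (2 * x) ^ k) has_real_derivative (- real k * c / sqrt (2 * x) ^ (k + 2))) (at x)"
proof -
  have "((\<lambda>x. inverse (sqrt (2 * x))) has_real_derivative - (inverse (sqrt (2 * x)) ^ 3)) (at x)"
    using assms by (auto intro!: derivative_eq_intros simp: field_simps power3_eq_cube)
  then have "((\<lambda>x. c * inverse (sqrt (2 * x)) ^ k) has_real_derivative
      c * (real k * (- (inverse (sqrt (2 * x)) ^ 3) * inverse (sqrt (2 * x)) ^ (k - Suc 0)))) (at x)"
    by (intro DERIV_cmult DERIV_power)
  \<comment> \<open>For \<open>k = 0\<close> the factor \<open>real k\<close> vanishes, so the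
    truncated exponent \<open>k - Suc 0\<close> is harmless.\<close>
  also have "c * (real k * (- (inverse (sqrt (2 * x)) ^ 3) * inverse (sqrt (2 * x)) ^ (k - Suc 0)))
      = - real k * c * inverse (sqrt (2 * x)) ^ (k + 2)"
    by (cases k) (simp_all add: numeral_3_eq_3 algebra_simps)
  finally show ?thesis by (simp add: divide_inverse power_inverse)
qed

lemma DERIV_profile:
  assumes "x > 0"
  shows "(profile c has_real_derivative profile_d1 c x) (at x)"
proof -
  have "((\<lambda>x. sqrt (2 * x)) has_real_derivative 1 / sqrt (2 * x)) (at x)"
    using assms by (auto intro!: derivative_eq_intros simp: field_simps)
  moreover have "((\<lambda>x. ln x / 6) has_real_derivative 1 / (6 * x)) (at x)"
    using assms by (auto intro!: derivative_eq_intros)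
  ultimately show ?thesis
    unfolding profile_def[abs_def] profile_d1_def
    using DERIV_diff[OF DERIV_add DERIV_inverse_sqrt_power[OF assms, of c 1]]
    by (fastforce simp: numeral_3_eq_3)
qed

lemma DERIV_profile_d1:
  assumes "x > 0"
  shows "(profile_d1 c has_real_derivative profile_d2 c x) (at x)"
proof -
  have "((\<lambda>x. 1 / (6 * x)) has_real_derivative - 1 / (6 * x\<^sup>2)) (at x)"
    using assms by (auto intro!: derivative_eq_intros simp: power2_eq_square)
  from DERIV_add[OF DERIV_add[OF DERIV_inverse_sqrt_power[OF assms, of 1 1] this]
      DERIV_inverse_sqrt_power[OF assms, of c 3]]
  show ?thesis unfolding profile_d1_def[abs_def] profile_d2_def
    by (rule DERIV_cong[THEN DERIV_cong_ev[THEN iffD1, rotated 3]]) (auto simp: numeral_eq_Suc)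
qed

lemma DERIV_profile_d2:
  assumes "x > 0"
  shows "(profile_d2 c has_real_derivative profile_d3 c x) (at x)"
proof -
  have "((\<lambda>x. 1 / (6 * x\<^sup>2)) has_real_derivative - 1 / (3 * x ^ 3)) (at x)"
    using assms by (auto intro!: derivative_eq_intros simp: field_simps power2_eq_square power3_eq_cube)
  from DERIV_diff[OF DERIV_diff[OF DERIV_inverse_sqrt_power[OF assms, of "-1" 3] this]
      DERIV_inverse_sqrt_power[OF assms, of "3 * c" 5]]
  show ?thesis unfolding profile_d2_def[abs_def] profile_d3_def
    by (rule DERIV_cong[THEN DERIV_cong_ev[THEN iffD1, rotated 3]]) (auto simp: numeral_eq_Suc)
qed

text \<open>The differences that matter look back by \<open>j\<close> up to about
  \<open>sqrt (2 * x)\<close>. In that range the cubic terms sum to the order of the margin created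
  by \<open>c\<close>, so they can stay as a remainder.\<close>

lemma profile_Taylor:
  assumes "0 < j" "j < x"
  obtains t where "x - j < t" "t < x"
    "profile c x - profile c (x - j) = profile_d1 c x * j - profile_d2 c x / 2 * j\<^sup>2 + profile_d3 c t / 6 * j ^ 3"
proof -
  define d where "d = (\<lambda>m::nat. if m = 0 then profile c else if m = 1 then profile_d1 c else if m = 2 then profile_d2 c else profile_d3 c)"
  have "\<exists>t>x - j. t < x \<and> profile c (x - j) =
      (\<Sum>m<3. d m x / fact m * ((x - j) - x) ^ m) + d 3 t / fact 3 * ((x - j) - x) ^ 3"
  proof (rule Taylor_down[where b = x])
    show "\<forall>m t. m < 3 \<and> x - j \<le> t \<and> t \<le> x \<longrightarrow> (d m has_real_derivative d (Suc m) t) (at t)"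
    proof (intro allI impI)
      fix m :: nat and t assume "m < 3 \<and> x - j \<le> t \<and> t \<le> x"
      moreover from this assms have "t > 0" by linarith
      ultimately show "(d m has_real_derivative d (Suc m) t) (at t)"
        using DERIV_profile[of t c] DERIV_profile_d1[of t c] DERIV_profile_d2[of t c]
        by (auto simp: d_def less_Suc_eq numeral_3_eq_3)
    qed
  qed (use assms in \<open>auto simp: d_def\<close>)
  then obtain t where "x - j < t" "t < x" "profile c (x - j) =
      (\<Sum>m<3. d m x / fact m * ((x - j) - x) ^ m) + d 3 t / fact 3 * ((x - j) - x) ^ 3" by blast
  then show ?thesis
    by (intro that[of t])
      (auto simp: d_def numeral_3_eq_3 power2_eq_square fact_numeral field_simps)
qed

section \<open>Sums of quadratic polynomials\<close>

text \<open>The polynomial that sums \<open>1 - \<alpha> * j - \<beta> * j\<^sup>2\<close> over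
  \<open>j < k\<close>; its argument is real because it is evaluated at
  \<open>sqrt (2 * x)\<close>.\<close>

definition quad_sum :: "real \<Rightarrow> real \<Rightarrow> real \<Rightarrow> real" where
  "quad_sum \<alpha> \<beta> k = k - \<alpha> * (k\<^sup>2 - k) / 2 - \<beta> * (k ^ 3 / 3 - k\<^sup>2 / 2 + k / 6)"
definition quad_sum_deriv :: "real \<Rightarrow> real \<Rightarrow> real \<Rightarrow> real" where
  "quad_sum_deriv \<alpha> \<beta> k = 1 - \<alpha> * (2 * k - 1) / 2 - \<beta> * (k\<^sup>2 - k + 1 / 6)"

lemma sum_eq_quad_sum: "(\<Sum>j<k. 1 - \<alpha> * real j - \<beta> * (real j)\<^sup>2) = quad_sum \<alpha> \<beta> (real k)"
  by (induction k) (simp_all add: quad_sum_def power2_eq_square power3_eq_cube field_simps)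

lemma quad_sum_shift: "quad_sum \<alpha> \<beta> (k + x) = quad_sum \<alpha> \<beta> k + quad_sum_deriv \<alpha> \<beta> k * x - (\<alpha> / 2 + \<beta> * k - \<beta> / 2) * x\<^sup>2 - \<beta> * x ^ 3 / 3"
  by (simp add: quad_sum_def quad_sum_deriv_def power2_eq_square power3_eq_cube field_simps)

text \<open>With \<open>u\<close> an approximate maximiser, completing the square absorbs the linear
  term of the expansion at \<open>u\<close> into \<open>(k - u)\<^sup>2 / (2 * u)\<close>, which
  \<alpha> supplies.\<close>

lemma quad_sum_le:
  assumes "\<alpha> \<ge> 1 / u" "\<beta> \<ge> 0" "u \<ge> 1" "k \<ge> 0"
  shows "quad_sum \<alpha> \<beta> k \<le> quad_sum \<alpha> \<beta> u + (quad_sum_deriv \<alpha> \<beta> u)\<^sup>2 * u / 2"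
proof -
  define x where "x = k - u"
  have k: "k = u + x" by (simp add: x_def)
  \<comment> \<open>The quadratic and cubic contributions of \<beta> combine into this factor; it is
    nonnegative because \<open>u + x = k \<ge> 0\<close> and \<open>u \<ge> 1\<close>.\<close>
  have "0 \<le> (u + x) / 3 + 2 * u / 3 - 1 / 2"
    using assms k by (simp add: field_simps)
  then have *: "0 \<le> \<beta> * x\<^sup>2 * ((u + x) / 3 + 2 * u / 3 - 1 / 2)"
    using assms by (intro mult_nonneg_nonneg) auto
  have "0 \<le> (quad_sum_deriv \<alpha> \<beta> u - x / u)\<^sup>2 * u / 2 + (\<alpha> - 1 / u) * x\<^sup>2 / 2" using assms by simp
  also have "\<dots> = (quad_sum_deriv \<alpha> \<beta> u)\<^sup>2 * u / 2 - quad_sum_deriv \<alpha> \<beta> u * x + \<alpha> * x\<^sup>2 / 2"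
    using assms by (simp add: field_simps power2_eq_square)
  finally have "0 \<le> ((quad_sum_deriv \<alpha> \<beta> u)\<^sup>2 * u / 2 - quad_sum_deriv \<alpha> \<beta> u * x + \<alpha> * x\<^sup>2 / 2) +
      \<beta> * x\<^sup>2 * ((u + x) / 3 + 2 * u / 3 - 1 / 2)"
    using * by (rule add_nonneg_nonneg)
  also have "\<dots> = quad_sum \<alpha> \<beta> u + (quad_sum_deriv \<alpha> \<beta> u)\<^sup>2 * u / 2 - quad_sum \<alpha> \<beta> k"
    unfolding k quad_sum_shift by (simp add: field_simps power2_eq_square power3_eq_cube)
  finally show ?thesis by simp
qed

text \<open>For rounding \<open>u\<close> down: a shift to the left by at most one costs at most the
  slope plus half the curvature at \<open>u\<close>, and the cubic term helps.\<close>

lemma quad_sum_ge: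
  assumes "\<alpha> \<ge> 0" "\<beta> \<ge> 0" "u \<ge> 1" "u - 1 \<le> k" "k \<le> u"
  shows "quad_sum \<alpha> \<beta> u - \<bar>quad_sum_deriv \<alpha> \<beta> u\<bar> - (\<alpha> / 2 + \<beta> * u - \<beta> / 2) \<le> quad_sum \<alpha> \<beta> k"
proof -
  define x where "x = k - u"
  have k: "k = u + x" and x: "\<bar>x\<bar> \<le> 1" "x \<le> 0" using assms by (auto simp: x_def)
  have "\<bar>quad_sum_deriv \<alpha> \<beta> u * x\<bar> \<le> \<bar>quad_sum_deriv \<alpha> \<beta> u\<bar> * 1" unfolding abs_mult
    using x by (intro mult_left_mono) auto
  moreover have "(\<alpha> / 2 + \<beta> * (u - 1 / 2)) * x\<^sup>2 \<le> (\<alpha> / 2 + \<beta> * (u - 1 / 2)) * 1"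
    using x assms by (intro mult_left_mono) (auto simp: abs_square_le_1)
  moreover have "\<beta> * x ^ 3 \<le> 0" using x assms
    by (simp add: mult_nonneg_nonpos power3_eq_cube mult_nonneg_nonpos2 zero_le_mult_iff mult_le_0_iff)
  ultimately show ?thesis unfolding k quad_sum_shift
    by (simp add: algebra_simps abs_le_iff)
qed

section \<open>Asymptotic inequalities in \<open>u = sqrt (2 * x)\<close>\<close>

text \<open>With \<open>u = sqrt (2 * x)\<close>, these are the coefficients of \<open>j\<close> and
  \<open>j\<^sup>2\<close> in the expansion of a profile difference, namely
  \<open>profile_d1\<close> and \<open>- profile_d2 / 2\<close>.\<close>

definition lin_coeff :: "real \<Rightarrow> real \<Rightarrow> real" where "lin_coeff c u = 1 / u + 1 / (3 * u\<^sup>2) + c / u ^ 3"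
definition quad_coeff :: "real \<Rightarrow> real \<Rightarrow> real" where "quad_coeff c u = (1 / u ^ 3 + 2 / (3 * u ^ 4) + 3 * c / u ^ 5) / 2"

lemma profile_d1_eq: "x > 0 \<Longrightarrow> profile_d1 c x = lin_coeff c (sqrt (2 * x))"
  by (simp add: profile_d1_def lin_coeff_def)

lemma profile_d2_eq: "x > 0 \<Longrightarrow> profile_d2 c x / 2 = - quad_coeff c (sqrt (2 * x))"
proof -
  assume "x > 0"
  then have "sqrt (2 * x) ^ 4 = 4 * x\<^sup>2" by (simp add: power4_eq_xxxx power2_eq_square)
  then show ?thesis by (simp add: profile_d2_def quad_coeff_def field_simps)
qed

lemma profile_increment:
  assumes "x > 0" and u: "u = sqrt (2 * x)"
  shows "x * (profile c (x + 1) - profile c x) = u\<^sup>2 / 2 * (sqrt (u\<^sup>2 + 2) + ln ((u\<^sup>2 + 2) / 2) / 6 -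
     c / sqrt (u\<^sup>2 + 2) - (u + ln (u\<^sup>2 / 2) / 6 - c / u))"
proof -
  have x: "u\<^sup>2 / 2 = x" "2 * (x + 1) = u\<^sup>2 + 2" "(u\<^sup>2 + 2) / 2 = x + 1" using assms by simp_all
  show ?thesis unfolding profile_def x by (simp only: u)
qed

text \<open>For a decreasing sequence the sum of positive parts is itself a partial sum, ending
  where the terms cease to be positive.\<close>

lemma sum_pos_part_le:
  fixes q :: "nat \<Rightarrow> real"
  assumes "antimono q" "\<And>k. (\<Sum>j<k. q j) \<le> B"
  shows "(\<Sum>j<m. max 0 (q j)) \<le> B"
proof (induction m)
  case 0
  show ?case using assms(2)[of 0] by simp
next
  case (Suc m)
  show ?case
  proof (cases "q m \<le> 0")
    case False
    then have "max 0 (q j) = q j" if "j \<le> m" for j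
      using antimonoD[OF assms(1) that] by simp
    then have "(\<Sum>j<Suc m. max 0 (q j)) = (\<Sum>j<Suc m. q j)" by (intro sum.cong) auto
    then show ?thesis using assms(2)[of "Suc m"] by simp
  qed (use Suc in simp)
qed

text \<open>The coefficient \<open>1 / 6\<close> of \<open>ln x\<close> is decided here: with
  \<open>a\<close> in its place, the constant terms would be \<open>1 / 3 - a\<close> for the sum
  and \<open>a\<close> for the increment. At order \<open>1 / u\<close> the parameter
  \<open>c\<close> enters the two sides with opposite signs, and \<open>c = 10\<close> leaves room
  for the margin \<open>1 / u\<close>.\<close>

lemma supersolution_asymp:
  "eventually (\<lambda>u. u \<ge> 1 \<and> quad_sum (lin_coeff 10 u) (quad_coeff 10 u) u \<le> u / 2 + 1 / 6 - 1 / u \<and>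
     \<bar>quad_sum_deriv (lin_coeff 10 u) (quad_coeff 10 u) u\<bar> \<le> 1 / u \<and>
     u / 2 + 1 / 6 \<le> u\<^sup>2 / 2 * (sqrt (u\<^sup>2 + 2) + ln ((u\<^sup>2 + 2) / 2) / 6 - 10 / sqrt (u\<^sup>2 + 2) -
       (u + ln (u\<^sup>2 / 2) / 6 - 10 / u))) at_top"
  unfolding quad_sum_def quad_sum_deriv_def lin_coeff_def quad_coeff_def abs_le_iff
  by (intro eventually_conj) real_asymp+

text \<open>The value \<open>-100\<close> outweighs losses of order \<open>1 / u\<close>: rounding
  \<open>u\<close> to an integer, and the cubic remainders, which total at most
  \<open>u ^ 4 * (24 / u ^ 5 + 64 / u ^ 6)\<close>.\<close>

lemma subsolution_asymp:
  "eventually (\<lambda>u. u \<ge> 4 \<and> lin_coeff (-100) u \<ge> 0 \<and> quad_coeff (-100) u \<ge> 0 \<and>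
     u\<^sup>2 / 2 * (sqrt (u\<^sup>2 + 2) + ln ((u\<^sup>2 + 2) / 2) / 6 - (-100) / sqrt (u\<^sup>2 + 2) -
       (u + ln (u\<^sup>2 / 2) / 6 - (-100) / u)) \<le>
     quad_sum (lin_coeff (-100) u) (quad_coeff (-100) u) u - \<bar>quad_sum_deriv (lin_coeff (-100) u) (quad_coeff (-100) u) u\<bar>
     - (lin_coeff (-100) u / 2 + quad_coeff (-100) u * u - quad_coeff (-100) u / 2) - u ^ 4 * (24 / u ^ 5 + 64 / u ^ 6)) at_top"
  unfolding quad_sum_def quad_sum_deriv_def lin_coeff_def quad_coeff_def
  by (intro eventually_conj) real_asymp+

lemma eventually_sqrt_Suc:
  assumes "eventually P at_top"
  obtains N where "\<And>n. n \<ge> N \<Longrightarrow> P (sqrt (2 * real (Suc n)))"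
proof -
  have "filterlim (\<lambda>n. sqrt (2 * real (Suc n))) at_top sequentially" by real_asymp
  from eventually_compose_filterlim[OF assms this] show ?thesis
    using that by (auto simp: eventually_sequentially)
qed

section \<open>Verification of the super- and subsolution\<close>

text \<open>Reversing the index by \<open>j = n - i\<close> and writing
  \<open>max a (1 + b) = a + max 0 (1 - (a - b))\<close> exposes positive parts of backward
  differences.\<close>

lemma sum_max_eq:
  "(\<Sum>i\<le>n. max (g (real (Suc n))) (1 + g (real (Suc i)))) =
   real (Suc n) * g (real (Suc n)) +
   (\<Sum>j<Suc n. max 0 (1 - (g (real (Suc n)) - g (real (Suc n) - real j))))"
proof -
  have "(\<Sum>i\<le>n. max (g (real (Suc n))) (1 + g (real (Suc i)))) =
    (\<Sum>j<Suc n. max (g (real (Suc n))) (1 + g (real (Suc (Suc n - Suc j)))))"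
    by (subst sum.nat_diff_reindex) (simp add: lessThan_Suc_atMost)
  also have "\<dots> = (\<Sum>j<Suc n. g (real (Suc n)) +
      max 0 (1 - (g (real (Suc n)) - g (real (Suc n) - real j))))"
  proof (intro sum.cong refl)
    fix j assume "j \<in> {..<Suc n}"
    then have "real (Suc (Suc n - Suc j)) = real (Suc n) - real j" by (simp add: of_nat_diff)
    then show "max (g (real (Suc n))) (1 + g (real (Suc (Suc n - Suc j)))) = g (real (Suc n)) +
        max 0 (1 - (g (real (Suc n)) - g (real (Suc n) - real j)))"
      by (simp only: max_def) auto
  qed
  finally show ?thesis by (simp add: sum.distrib)
qed

text \<open>The argument is shifted by one since \<^const>\<open>profile\<close> is singular at \<open>0\<close>.\<close>

lemma profile_supersolution:
  "\<exists>N. \<forall>n\<ge>N. (\<Sum>i\<le>n. max (profile 10 (real (Suc n))) (1 + profile 10 (real (Suc i)))) \<le>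
     real (Suc n) * profile 10 (real (Suc (Suc n)))"
proof -
  obtain N where N: "\<And>n u. n \<ge> N \<Longrightarrow> u = sqrt (2 * real (Suc n)) \<Longrightarrow>
     u \<ge> 1 \<and> quad_sum (lin_coeff 10 u) (quad_coeff 10 u) u \<le> u / 2 + 1 / 6 - 1 / u \<and>
     \<bar>quad_sum_deriv (lin_coeff 10 u) (quad_coeff 10 u) u\<bar> \<le> 1 / u \<and>
     u / 2 + 1 / 6 \<le> u\<^sup>2 / 2 * (sqrt (u\<^sup>2 + 2) + ln ((u\<^sup>2 + 2) / 2) / 6 - 10 / sqrt (u\<^sup>2 + 2) -
       (u + ln (u\<^sup>2 / 2) / 6 - 10 / u))"
    using eventually_sqrt_Suc[OF supersolution_asymp] by metis
  show ?thesis
  proof (intro exI allI impI)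
    fix n assume "n \<ge> N"
    define x where "x = real (Suc n)"
    define u where "u = sqrt (2 * x)"
    define q where "q = (\<lambda>j. 1 - lin_coeff 10 u * real j - quad_coeff 10 u * (real j)\<^sup>2)"
    note u = N[OF \<open>n \<ge> N\<close> u_def[unfolded x_def]]
    have x: "x > 0" by (simp add: x_def)
    have pos: "lin_coeff 10 u \<ge> 1 / u" "1 / u > 0" "lin_coeff 10 u \<ge> 0" "quad_coeff 10 u \<ge> 0"
      using u by (auto simp: lin_coeff_def quad_coeff_def)
    have le: "1 - (profile 10 x - profile 10 (x - real j)) \<le> q j" if "j < Suc n" for j
    proof (cases "j = 0")
      case False
      then have "0 < real j" "real j < x" using that by (auto simp: x_def)
      from profile_Taylor[OF this, of 10] obtain t where t: "x - real j < t" and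
        eq: "profile 10 x - profile 10 (x - real j) = profile_d1 10 x * real j - profile_d2 10 x / 2 * (real j)\<^sup>2 + profile_d3 10 t / 6 * real j ^ 3"
        by metis
      have "t > 0" using t \<open>real j < x\<close> by simp
      \<comment> \<open>For \<open>c = 10\<close> every term of the third derivative is positive, so
        the remainder only lowers the left-hand side.\<close>
      then have "profile_d3 10 t / 6 * real j ^ 3 \<ge> 0" by (simp add: profile_d3_def)
      then show ?thesis
        unfolding eq profile_d1_eq[OF x] profile_d2_eq[OF x] q_def u_def by simp
    qed (simp add: q_def)
    have "(\<Sum>j<Suc n. max 0 (q j)) \<le> u / 2 + 1 / 6"
    proof (rule sum_pos_part_le)
      show "antimono q" unfolding q_def
        using pos by (intro antimonoI diff_mono mult_left_mono) (auto simp: power_mono)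
      fix k
      \<comment> \<open>The slope at \<open>u\<close> is so small that the square term is at most
        \<open>1 / (2 * u)\<close>, within the margin \<open>1 / u\<close>.\<close>
      have "(quad_sum_deriv (lin_coeff 10 u) (quad_coeff 10 u) u)\<^sup>2 \<le> (1 / u)\<^sup>2"
        using u by (metis abs_le_square_iff abs_of_pos pos(2))
      then have "(quad_sum_deriv (lin_coeff 10 u) (quad_coeff 10 u) u)\<^sup>2 * u / 2 \<le> (1 / u)\<^sup>2 * u / 2"
        using u by (intro divide_right_mono mult_right_mono) auto
      also have "\<dots> \<le> 1 / u" using u by (simp add: field_simps power2_eq_square)
      finally show "(\<Sum>j<k. q j) \<le> u / 2 + 1 / 6"
        unfolding q_def sum_eq_quad_sum using quad_sum_le[of u "lin_coeff 10 u" "quad_coeff 10 u" "real k"] pos u by simp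
    qed
    also have "\<dots> \<le> x * (profile 10 (x + 1) - profile 10 x)"
      unfolding profile_increment[OF x u_def] using u by blast
    finally have "(\<Sum>j<Suc n. max 0 (q j)) \<le> x * (profile 10 (x + 1) - profile 10 x)" .
    moreover have "(\<Sum>j<Suc n. max 0 (1 - (profile 10 x - profile 10 (x - real j)))) \<le> (\<Sum>j<Suc n. max 0 (q j))"
      using le by (intro sum_mono max.mono) auto
    ultimately show "(\<Sum>i\<le>n. max (profile 10 (real (Suc n))) (1 + profile 10 (real (Suc i)))) \<le>
       real (Suc n) * profile 10 (real (Suc (Suc n)))"
      unfolding sum_max_eq x_def by (simp add: algebra_simps)
  qed
qed

text \<open>From \<open>t \<ge> u\<^sup>2 / 4\<close> follows
  \<open>sqrt (2 * t) \<ge> u / 2\<close>, which controls the positive terms with constants to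
  spare; the term with \<open>c\<close> is nonpositive and dropped.\<close>

lemma profile_d3_le:
  assumes "u > 0" "t \<ge> u\<^sup>2 / 4" "c \<le> 0"
  shows "profile_d3 c t / 6 \<le> 24 / u ^ 5 + 64 / u ^ 6"
proof -
  have t: "t > 0" using assms by (smt (verit) divide_pos_pos zero_less_power)
  have "(u / 2) ^ 5 \<le> sqrt (2 * t) ^ 5"
  proof (rule power_mono)
    show "u / 2 \<le> sqrt (2 * t)" using assms t by (intro real_le_rsqrt) (simp add: power2_eq_square)
  qed (use assms in simp)
  then have "3 / sqrt (2 * t) ^ 5 \<le> 3 / (u / 2) ^ 5"
    using assms t by (intro divide_left_mono mult_pos_pos zero_less_power) auto
  moreover have "(u\<^sup>2 / 4) ^ 3 \<le> t ^ 3" using assms by (intro power_mono) auto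
  then have "1 / (3 * t ^ 3) \<le> 1 / (3 * (u\<^sup>2 / 4) ^ 3)"
    using assms t by (intro divide_left_mono mult_left_mono) auto
  moreover have "15 * c / sqrt (2 * t) ^ 7 \<le> 0" using assms t by (simp add: divide_nonpos_pos)
  moreover have "3 / (u / 2) ^ 5 = 96 / u ^ 5" "1 / (3 * (u\<^sup>2 / 4) ^ 3) = 64 / (3 * u ^ 6)"
    using assms by (simp_all add: power_divide flip: power_mult)
  moreover have "96 / u ^ 5 \<le> 144 / u ^ 5" "64 / (3 * u ^ 6) \<le> 384 / u ^ 6"
    using assms by (simp_all add: field_simps)
  ultimately show ?thesis unfolding profile_d3_def by simp
qed

text \<open>Positive parts may be discarded in a lower bound, so only indices below
  \<open>sqrt (2 * x)\<close> are kept; the quadratic approximation changes sign near there and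
  little is lost. The cubic remainder may now have the wrong sign and is bounded uniformly.\<close>

lemma profile_subsolution:
  "\<exists>N. \<forall>n\<ge>N. real (Suc n) * profile (-100) (real (Suc (Suc n))) \<le>
     (\<Sum>i\<le>n. max (profile (-100) (real (Suc n))) (1 + profile (-100) (real (Suc i))))"
proof -
  obtain N where N: "\<And>n u. n \<ge> N \<Longrightarrow> u = sqrt (2 * real (Suc n)) \<Longrightarrow>
     u \<ge> 4 \<and> lin_coeff (-100) u \<ge> 0 \<and> quad_coeff (-100) u \<ge> 0 \<and>
     u\<^sup>2 / 2 * (sqrt (u\<^sup>2 + 2) + ln ((u\<^sup>2 + 2) / 2) / 6 - (-100) / sqrt (u\<^sup>2 + 2) -
       (u + ln (u\<^sup>2 / 2) / 6 - (-100) / u)) \<le>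
     quad_sum (lin_coeff (-100) u) (quad_coeff (-100) u) u - \<bar>quad_sum_deriv (lin_coeff (-100) u) (quad_coeff (-100) u) u\<bar>
     - (lin_coeff (-100) u / 2 + quad_coeff (-100) u * u - quad_coeff (-100) u / 2) - u ^ 4 * (24 / u ^ 5 + 64 / u ^ 6)"
    using eventually_sqrt_Suc[OF subsolution_asymp] by metis
  show ?thesis
  proof (intro exI allI impI)
    fix n assume "n \<ge> N"
    define c :: real where "c = -100"
    define x where "x = real (Suc n)"
    define u where "u = sqrt (2 * x)"
    define \<gamma> where "\<gamma> = 24 / u ^ 5 + 64 / u ^ 6"
    define k where "k = nat \<lfloor>u\<rfloor>"
    note u = N[OF \<open>n \<ge> N\<close> u_def[unfolded x_def], folded c_def]
    have x: "x > 0" by (simp add: x_def)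
    have ux: "u\<^sup>2 = 2 * x" using x by (simp add: u_def)
    \<comment> \<open>Through \<open>u \<le> x / 2\<close>, every intermediate point satisfies
      \<open>t > x - j \<ge> x / 2 = u\<^sup>2 / 4\<close>, as \<open>profile_d3_le\<close>
      requires.\<close>
    have "4 * u \<le> u * u" using u by (intro mult_right_mono) auto
    then have ux2: "u \<le> x / 2" using ux by (simp add: power2_eq_square)
    have k: "real k \<le> u" "u - 1 \<le> real k" using u unfolding k_def by linarith+
    then have "real k \<le> x" using ux2 x by simp
    then have kn: "k \<le> Suc n" unfolding x_def by (simp only: of_nat_le_iff)
    have \<gamma>: "\<gamma> \<ge> 0" using u by (simp add: \<gamma>_def)
    have ge: "1 - lin_coeff c u * real j - quad_coeff c u * (real j)\<^sup>2 - \<gamma> * u ^ 3 \<le> 1 - (profile c x - profile c (x - real j))"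
      if "j < k" for j
    proof (cases "j = 0")
      case False
      then have j: "0 < real j" "real j < x" "real j \<le> u" using that k kn by (auto simp: x_def)
      from profile_Taylor[OF this(1,2), of c] obtain t where t: "x - real j < t" and
        eq: "profile c x - profile c (x - real j) = profile_d1 c x * real j - profile_d2 c x / 2 * (real j)\<^sup>2 + profile_d3 c t / 6 * real j ^ 3"
        by metis
      have "profile_d3 c t / 6 \<le> \<gamma>" unfolding \<gamma>_def
        using t j ux ux2 u by (intro profile_d3_le) (auto simp: c_def)
      then have "profile_d3 c t / 6 * real j ^ 3 \<le> \<gamma> * u ^ 3"
        using \<gamma> j by (intro mult_mono power_mono) auto
      then show ?thesis
        unfolding eq profile_d1_eq[OF x] profile_d2_eq[OF x] u_def by simp
    qed (use u \<gamma> in simp)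
    have "x * (profile c (x + 1) - profile c x) \<le> quad_sum (lin_coeff c u) (quad_coeff c u) u - \<bar>quad_sum_deriv (lin_coeff c u) (quad_coeff c u) u\<bar>
       - (lin_coeff c u / 2 + quad_coeff c u * u - quad_coeff c u / 2) - u ^ 4 * \<gamma>"
      unfolding profile_increment[OF x u_def] \<gamma>_def using u by blast
    also have "\<dots> \<le> quad_sum (lin_coeff c u) (quad_coeff c u) (real k) - u ^ 4 * \<gamma>"
      using quad_sum_ge[of "lin_coeff c u" "quad_coeff c u" u "real k"] u k by simp
    \<comment> \<open>At most \<open>u\<close> summands carry an error of at most
      \<open>\<gamma> * u ^ 3\<close> each, whence the term \<open>u ^ 4 * \<gamma>\<close>.\<close>
    also have "real k * (\<gamma> * u ^ 3) \<le> u * (\<gamma> * u ^ 3)"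
      using k \<gamma> u by (intro mult_right_mono) auto
    then have "quad_sum (lin_coeff c u) (quad_coeff c u) (real k) - u ^ 4 * \<gamma> \<le>
        (\<Sum>j<k. 1 - lin_coeff c u * real j - quad_coeff c u * (real j)\<^sup>2) - real k * (\<gamma> * u ^ 3)"
      unfolding sum_eq_quad_sum by (simp add: power_numeral_reduce mult_ac)
    also have "\<dots> = (\<Sum>j<k. 1 - lin_coeff c u * real j - quad_coeff c u * (real j)\<^sup>2 - \<gamma> * u ^ 3)"
      by (simp add: sum_subtractf)
    also have "\<dots> \<le> (\<Sum>j<k. max 0 (1 - (profile c x - profile c (x - real j))))"
      using ge by (intro sum_mono max.coboundedI2) auto
    also have "\<dots> \<le> (\<Sum>j<Suc n. max 0 (1 - (profile c x - profile c (x - real j))))"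
      using kn by (intro sum_mono2) auto
    finally show "real (Suc n) * profile (-100) (real (Suc (Suc n))) \<le>
     (\<Sum>i\<le>n. max (profile (-100) (real (Suc n))) (1 + profile (-100) (real (Suc i))))"
      unfolding sum_max_eq x_def c_def by (simp add: algebra_simps)
  qed
qed

text \<open>Both profiles, with argument shifted by one, differ from the target by a convergent and
  hence bounded sequence.\<close>

lemma bellman_asymp:
  "\<exists>C. \<forall>n\<ge>1. \<bar>bellman n - sqrt (2 * real n) - ln (real n) / 6\<bar> \<le> C"
proof -
  have close: "(\<lambda>n. profile c (real (Suc n)) - sqrt (2 * real n) - ln (real n) / 6) \<longlonglongrightarrow> 0" for c
    unfolding profile_def by real_asymp
  have bdd: "\<exists>B. \<forall>n. \<bar>profile c (real (Suc n)) - sqrt (2 * real n) - ln (real n) / 6\<bar> \<le> B" for c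
    using convergent_imp_Bseq[OF convergentI[OF close[of c]]] by (auto simp: Bseq_def)
  obtain B1 B2 where B:
    "\<And>n. \<bar>profile 10 (real (Suc n)) - sqrt (2 * real n) - ln (real n) / 6\<bar> \<le> B1"
    "\<And>n. \<bar>profile (-100) (real (Suc n)) - sqrt (2 * real n) - ln (real n) / 6\<bar> \<le> B2"
    using bdd[of 10] bdd[of "-100"] by metis
  obtain C1 where C1: "\<And>n. bellman n \<le> profile 10 (real (Suc n)) + C1"
    using profile_supersolution bellman_le_supersolution[of _ "\<lambda>n. profile 10 (real (Suc n))"] by metis
  obtain C2 where C2: "\<And>n. profile (-100) (real (Suc n)) - C2 \<le> bellman n"
    using profile_subsolution bellman_ge_subsolution[of _ "\<lambda>n. profile (-100) (real (Suc n))"] by metis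
  show ?thesis
  proof (intro exI allI impI)
    fix n :: nat
    show "\<bar>bellman n - sqrt (2 * real n) - ln (real n) / 6\<bar> \<le> max (B1 + C1) (B2 + C2)"
      using B[of n] C1[of n] C2[of n] unfolding abs_le_iff by linarith
  qed
qed
subsection \<open>Adapted selection rules\<close>

text \<open>For \<open>k \<le> n\<close> the classes within \<open>perms n\<close> are the atoms of
  \<open>perm_filtration n (enat k)\<close>, so measurability becomes invariance under this
  relation.\<close>

definition same_prefix :: "nat \<Rightarrow> (nat \<Rightarrow> nat) \<Rightarrow> (nat \<Rightarrow> nat) \<Rightarrow> bool" where
  "same_prefix k \<pi> \<pi>' \<longleftrightarrow> (\<forall>i\<in>{1..k}. \<pi> i = \<pi>' i)"

definition adapted :: "nat \<Rightarrow> (nat \<Rightarrow> (nat \<Rightarrow> nat) \<Rightarrow> bool) \<Rightarrow> bool" where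
  "adapted n c \<longleftrightarrow> (\<forall>k\<in>{1..n}. \<forall>\<pi>\<in>perms n. \<forall>\<pi>'\<in>perms n. same_prefix k \<pi> \<pi>' \<longrightarrow> c k \<pi> = c k \<pi>')"

lemma adaptedD:
  "adapted n c \<Longrightarrow> k \<in> {1..n} \<Longrightarrow> \<pi> \<in> perms n \<Longrightarrow> \<pi>' \<in> perms n \<Longrightarrow> same_prefix k \<pi> \<pi>' \<Longrightarrow>
    c k \<pi> = c k \<pi>'"
  unfolding adapted_def by blast

lemma same_prefix_mono: "same_prefix k \<pi> \<pi>' \<Longrightarrow> i \<le> k \<Longrightarrow> same_prefix i \<pi> \<pi>'"
  by (auto simp: same_prefix_def)

lemma same_prefix_sym: "same_prefix k \<pi> \<pi>' \<Longrightarrow> same_prefix k \<pi>' \<pi>"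
  by (auto simp: same_prefix_def)

section \<open>Measurable events as unions of prefix classes\<close>

text \<open>Invariance holds for the generating events and survives countable unions and, by
  symmetry of the relation, complements.\<close>

lemma perm_filtration_imp_prefix:
  assumes "A \<in> sets (perm_filtration n (enat k))" "\<pi> \<in> A" "\<pi>' \<in> perms n" "same_prefix k \<pi> \<pi>'"
  shows "\<pi>' \<in> A"
proof -
  have "A \<in> sigma_sets (perms n) {{\<pi> \<in> perms n. \<pi> i = v} | i v. i \<in> {1..n} \<and> enat i \<le> enat k}"
    using assms(1) by (simp only: sets_perm_filtration)
  then have "\<forall>\<pi>\<in>perms n. \<forall>\<pi>'\<in>perms n. same_prefix k \<pi> \<pi>' \<longrightarrow> \<pi> \<in> A \<longrightarrow> \<pi>' \<in> A"
  proof (induction rule: sigma_sets.induct)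
    case (Basic a)
    then show ?case by (auto simp: same_prefix_def)
  next
    case (Compl a)
    then show ?case using same_prefix_sym by blast
  qed blast+
  moreover have "\<pi> \<in> perms n" using sets.sets_into_space[OF assms(1)] assms(2) by auto
  ultimately show ?thesis using assms by blast
qed

text \<open>Such a set is a finite union of classes, each a finite intersection of generating
  events.\<close>

lemma perm_filtrationI_prefix:
  assumes "A \<subseteq> perms n" "k \<le> n"
    "\<And>\<pi> \<pi>'. \<pi> \<in> A \<Longrightarrow> \<pi>' \<in> perms n \<Longrightarrow> same_prefix k \<pi> \<pi>' \<Longrightarrow> \<pi>' \<in> A"
  shows "A \<in> sets (perm_filtration n (enat k))"
proof -
  let ?M = "perm_filtration n (enat k)"
  have atom: "{\<pi>' \<in> perms n. same_prefix k \<pi> \<pi>'} \<in> sets ?M" for \<pi>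
  proof -
    have "{\<pi>' \<in> space ?M. \<forall>i\<in>{1..k}. \<pi> i = \<pi>' i} \<in> sets ?M"
    proof (rule sets.sets_Collect_finite_All)
      fix i assume "i \<in> {1..k}"
      then have "{\<pi>' \<in> perms n. \<pi>' i = \<pi> i} \<in> sets ?M"
        unfolding sets_perm_filtration using assms(2) by (intro sigma_sets.Basic) auto
      then show "{\<pi>' \<in> space ?M. \<pi> i = \<pi>' i} \<in> sets ?M" by (simp add: eq_commute)
    qed simp
    then show ?thesis by (simp add: same_prefix_def)
  qed
  have "A = (\<Union>\<pi>\<in>A. {\<pi>' \<in> perms n. same_prefix k \<pi> \<pi>'})"
  proof (intro equalityI subsetI)
    fix \<pi> assume "\<pi> \<in> A"
    then have "\<pi> \<in> {\<pi>' \<in> perms n. same_prefix k \<pi> \<pi>'}" using assms(1) by (auto simp: same_prefix_def)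
    then show "\<pi> \<in> (\<Union>\<pi>\<in>A. {\<pi>' \<in> perms n. same_prefix k \<pi> \<pi>'})" using \<open>\<pi> \<in> A\<close> by blast
  qed (use assms(3) in blast)
  also have "\<dots> \<in> sets ?M"
    using finite_subset[OF assms(1) finite_perms] atom by (rule sets.finite_UN)
  finally show ?thesis .
qed

text \<open>The length of the chain selected so far, its last value (\<open>0\<close> if it is empty), and whether all
  selections so far belong to the chain.\<close>

fun chain_state :: "(nat \<Rightarrow> (nat \<Rightarrow> nat) \<Rightarrow> bool) \<Rightarrow> nat \<Rightarrow> (nat \<Rightarrow> nat) \<Rightarrow> nat \<times> nat \<times> bool" where
  "chain_state c 0 \<pi> = (0, 0, True)"
| "chain_state c (Suc k) \<pi> = (case chain_state c k \<pi> of (l, m, a) \<Rightarrow>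
     if a \<and> c (Suc k) \<pi> then if m < \<pi> (Suc k) then (Suc l, \<pi> (Suc k), True) else (l, m, False)
     else (l, m, a))"

lemma chain_state_prefix:
  assumes "adapted n c" "\<pi> \<in> perms n" "\<pi>' \<in> perms n" "k \<le> n" "same_prefix k \<pi> \<pi>'"
  shows "chain_state c k \<pi> = chain_state c k \<pi>'"
  using assms(4,5)
proof (induction k)
  case (Suc k)
  have "c (Suc k) \<pi> = c (Suc k) \<pi>'" "\<pi> (Suc k) = \<pi>' (Suc k)"
    using adaptedD[OF assms(1) _ assms(2,3) Suc.prems(2)] Suc.prems by (simp_all add: same_prefix_def)
  moreover have "chain_state c k \<pi> = chain_state c k \<pi>'"
    using Suc.prems same_prefix_mono[OF Suc.prems(2), of k] by (intro Suc.IH) simp_all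
  ultimately show ?case by (simp only: chain_state.simps)
qed simp

section \<open>Correspondence between strategies and adapted rules\<close>

definition selected_at :: "(nat \<Rightarrow> (nat \<Rightarrow> nat) \<Rightarrow> enat) \<Rightarrow> nat \<Rightarrow> (nat \<Rightarrow> nat) \<Rightarrow> bool" where
  "selected_at \<tau> k \<pi> \<longleftrightarrow> (\<exists>j\<ge>1. \<tau> j \<pi> = enat k)"

text \<open>If \<open>\<tau> j\<close> equals \<open>k\<close> on one permutation, it is at most
  \<open>k\<close> on any other with the same prefix, and not smaller, since stopping by time
  \<open>k - 1\<close> would transfer back.\<close>

lemma adapted_selected_at:
  assumes "feasible_strategy n \<tau>"
  shows "adapted n (selected_at \<tau>)"
proof -
  have imp: "selected_at \<tau> k \<pi>'" if k: "k \<in> {1..n}" and \<pi>: "\<pi> \<in> perms n" "\<pi>' \<in> perms n" "same_prefix k \<pi> \<pi>'"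
    and sel: "selected_at \<tau> k \<pi>" for k \<pi> \<pi>'
  proof -
    from sel obtain j where j: "j \<ge> 1" "\<tau> j \<pi> = enat k" unfolding selected_at_def by blast
    have "stopping_time (perm_filtration n) (\<tau> j)"
      using assms j by (simp add: feasible_strategy_def)
    then have meas: "{\<pi> \<in> perms n. \<tau> j \<pi> \<le> enat i} \<in> sets (perm_filtration n (enat i))" for i
      unfolding stopping_time_def pred_def space_perm_filtration by blast
    have transfer: "\<tau> j \<rho>' \<le> enat i" if "\<tau> j \<rho> \<le> enat i" "\<rho> \<in> perms n" "\<rho>' \<in> perms n" "same_prefix i \<rho> \<rho>'"
      for i \<rho> \<rho>'
    proof -
      have "\<rho> \<in> {\<pi> \<in> perms n. \<tau> j \<pi> \<le> enat i}" using that by blast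
      from perm_filtration_imp_prefix[OF meas this that(3,4)] show ?thesis by blast
    qed
    have le: "\<tau> j \<pi>' \<le> enat k" by (rule transfer[OF _ \<pi>]) (simp add: j(2))
    then obtain i where i: "\<tau> j \<pi>' = enat i" by (cases "\<tau> j \<pi>'") simp_all
    have "i \<le> k" using le i by simp
    moreover have "\<not> i \<le> k - 1"
    proof
      assume "i \<le> k - 1"
      then have *: "\<tau> j \<pi>' \<le> enat (k - 1)" using i by simp
      have "same_prefix (k - 1) \<pi>' \<pi>"
        by (rule same_prefix_sym[OF same_prefix_mono[OF \<pi>(3)]]) simp
      from transfer[OF * \<pi>(2,1) this] have "k \<le> k - 1" unfolding j(2) enat_ord_simps(1) .
      moreover have "1 \<le> k" using k by simp
      ultimately show False by linarith
    qed
    ultimately have "i = k" by linarith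
    then show ?thesis using j(1) i unfolding selected_at_def by blast
  qed
  show ?thesis
    unfolding adapted_def
  proof (intro ballI impI)
    fix k \<pi> \<pi>' assume *: "k \<in> {1..n}" "\<pi> \<in> perms n" "\<pi>' \<in> perms n" "same_prefix k \<pi> \<pi>'"
    show "selected_at \<tau> k \<pi> = selected_at \<tau> k \<pi>'"
      using imp[OF *] imp[OF *(1,3,2) same_prefix_sym[OF *(4)]] by blast
  qed
qed

text \<open>An invariant over time: while the flag is set, \<open>l\<close> counts all selections so
  far; once it is cleared, selection \<open>l + 1\<close> has broken the chain and \<open>l\<close>
  is final.\<close>

lemma selected_length_eq_chain_state:
  assumes "feasible_strategy n \<tau>" "\<pi> \<in> perms n"
  shows "selected_length n \<tau> \<pi> = fst (chain_state (selected_at \<tau>) n \<pi>)"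
proof -
  have range: "\<tau> j \<pi> \<in> enat ` {1..n} \<union> {\<infinity>}" if "j \<ge> 1" for j
    using assms that by (simp add: feasible_strategy_def)
  have ge1: "\<tau> j \<pi> \<ge> 1" if "j \<ge> 1" for j
    using range[OF that] by (auto simp: one_enat_def)
  have step: "\<tau> j \<pi> < \<tau> (Suc j) \<pi> \<or> (\<tau> j \<pi> = \<infinity> \<and> \<tau> (Suc j) \<pi> = \<infinity>)" if "j \<ge> 1" for j
    using assms that by (simp add: feasible_strategy_def)
  have mono: "\<tau> i \<pi> \<le> \<tau> j \<pi>" if "1 \<le> i" "i \<le> j" for i j
    using that(2)
  proof (induction rule: dec_induct)
    case (step j)
    then show ?case using \<open>1 \<le> i\<close> \<open>\<And>j. j \<ge> 1 \<Longrightarrow> \<tau> j \<pi> < \<tau> (Suc j) \<pi> \<or> _\<close>[of j]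
      by (auto intro: order_trans)
  qed simp
  define chain where "chain = (\<lambda>q. \<forall>j\<in>{1..<q}. \<tau> j \<pi> < \<tau> (Suc j) \<pi> \<and>
      \<pi> (the_enat (\<tau> j \<pi>)) < \<pi> (the_enat (\<tau> (Suc j) \<pi>)))"
  have inv: "case chain_state (selected_at \<tau>) k \<pi> of (l, m, a) \<Rightarrow>
     (\<forall>j\<in>{1..l}. \<tau> j \<pi> \<le> enat k) \<and> chain l \<and> m = (if l = 0 then 0 else \<pi> (the_enat (\<tau> l \<pi>))) \<and>
     (if a then \<tau> (Suc l) \<pi> > enat k else l \<ge> 1 \<and> \<not> \<pi> (the_enat (\<tau> l \<pi>)) < \<pi> (the_enat (\<tau> (Suc l) \<pi>)))"
    if "k \<le> n" for k
    using that
  proof (induction k)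
    case 0
    have "\<tau> (Suc 0) \<pi> > 0" using ge1[of 1] by (simp add: Suc_ile_eq one_enat_def zero_enat_def)
    then show ?case by (simp add: chain_def zero_enat_def)
  next
    case (Suc k)
    obtain l m a where st: "chain_state (selected_at \<tau>) k \<pi> = (l, m, a)" by (metis prod_cases3)
    have IH: "\<And>j. 1 \<le> j \<Longrightarrow> j \<le> l \<Longrightarrow> \<tau> j \<pi> \<le> enat k" "chain l"
      "m = (if l = 0 then 0 else \<pi> (the_enat (\<tau> l \<pi>)))"
      "if a then \<tau> (Suc l) \<pi> > enat k else l \<ge> 1 \<and> \<not> \<pi> (the_enat (\<tau> l \<pi>)) < \<pi> (the_enat (\<tau> (Suc l) \<pi>))"
      using Suc.IH Suc.prems st by auto
    have le: "\<forall>j\<in>{1..l}. \<tau> j \<pi> \<le> enat (Suc k)"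
      using IH(1) by (meson atLeastAtMost_iff enat_ord_simps(1) le_SucI order_trans order_refl)
    show ?case
    proof (cases "a \<and> selected_at \<tau> (Suc k) \<pi>")
      case False
      have "\<tau> (Suc l) \<pi> > enat (Suc k)" if a
      proof -
        have "\<tau> (Suc l) \<pi> \<noteq> enat (Suc k)" using False that by (auto simp: selected_at_def)
        moreover have "\<tau> (Suc l) \<pi> \<ge> enat (Suc k)" using IH(4) that by (simp add: Suc_ile_eq)
        ultimately show ?thesis by simp
      qed
      then show ?thesis using False st le IH by auto
    next
      case True
      then obtain j where j: "j \<ge> 1" "\<tau> j \<pi> = enat (Suc k)" by (auto simp: selected_at_def)
      have gt: "\<tau> (Suc l) \<pi> > enat k" using IH(4) True by simp
      \<comment> \<open>The selection at time \<open>Suc k\<close> is number \<open>l + 1\<close>: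
        the first \<open>l\<close> occurred by time \<open>k\<close>, and number
        \<open>l + 1\<close> comes no later than number \<open>j\<close>.\<close>
      have "j > l" using IH(1)[of j] j by (cases "j \<le> l") auto
      then have "\<tau> (Suc l) \<pi> \<le> enat (Suc k)" using mono[of "Suc l" j] j by simp
      then have eq: "\<tau> (Suc l) \<pi> = enat (Suc k)" using gt by (simp add: Suc_ile_eq[symmetric])
      have lt: "\<tau> l \<pi> < \<tau> (Suc l) \<pi>" if "l \<ge> 1" using step[OF that] eq by auto
      \<comment> \<open>The default \<open>m = 0\<close> lies below every value, so a first
        selection always extends the chain.\<close>
      have m_iff: "m < \<pi> (Suc k) \<longleftrightarrow> l = 0 \<or> \<pi> (the_enat (\<tau> l \<pi>)) < \<pi> (the_enat (\<tau> (Suc l) \<pi>))"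
      proof (cases "l = 0")
        case l0: True
        have "\<pi> (Suc k) \<in> {1..n}"
          using assms(2) Suc.prems permutes_in_image[of \<pi> "{1..n}" "Suc k"] by (auto simp: perms_def)
        then show ?thesis using IH(3) l0 by simp
      qed (use IH(3) eq in simp)
      have "\<tau> (Suc (Suc l)) \<pi> > enat (Suc k)" using step[of "Suc l"] eq by auto
      moreover have "chain (Suc l)" if "m < \<pi> (Suc k)"
        using IH(2) m_iff that lt unfolding chain_def by (auto simp: less_Suc_eq)
      moreover have "\<forall>j\<in>{1..Suc l}. \<tau> j \<pi> \<le> enat (Suc k)" using le eq by (auto simp: le_Suc_eq)
      ultimately show ?thesis using True st le IH m_iff eq by auto
    qed
  qed
  obtain l m a where st: "chain_state (selected_at \<tau>) n \<pi> = (l, m, a)" by (metis prod_cases3)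
  have I: "\<forall>j\<in>{1..l}. \<tau> j \<pi> \<le> enat n" "chain l"
    "if a then \<tau> (Suc l) \<pi> > enat n else l \<ge> 1 \<and> \<not> \<pi> (the_enat (\<tau> l \<pi>)) < \<pi> (the_enat (\<tau> (Suc l) \<pi>))"
    using inv[of n] st by auto
  have "selected_length n \<tau> \<pi> = l"
    unfolding selected_length_def
  proof (rule Max_eqI[OF selected_length_finite], goal_cases)
    case (1 q)
    \<comment> \<open>A longer chain would contain selection \<open>l + 1\<close>, made by time
      \<open>n\<close> and fitting the chain; both cases of the invariant exclude this.\<close>
    show "q \<le> l"
    proof (rule ccontr)
      assume "\<not> q \<le> l"
      then have "\<tau> (Suc l) \<pi> \<le> enat n" "l \<ge> 1 \<Longrightarrow> \<pi> (the_enat (\<tau> l \<pi>)) < \<pi> (the_enat (\<tau> (Suc l) \<pi>))"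
        using 1 by auto
      then show False using I(3) by (auto split: if_splits)
    qed
  next
    case 2
    show ?case using I(1,2) ge1 unfolding chain_def by auto
  qed
  then show ?thesis using st by simp
qed

text \<open>Selection \<open>j\<close> is made when the number \<open>N\<close> of times chosen by
  \<open>c\<close> first reaches \<open>j\<close>.\<close>

lemma obtain_strategy:
  assumes "adapted n c"
  obtains \<tau> where "feasible_strategy n \<tau>"
    "\<And>\<pi> k. \<pi> \<in> perms n \<Longrightarrow> k \<in> {1..n} \<Longrightarrow> selected_at \<tau> k \<pi> = c k \<pi>"
proof -
  define N where "N = (\<lambda>k \<pi>. card {i\<in>{1..k}. c i \<pi>})"
  define \<tau> where "\<tau> = (\<lambda>j \<pi>. if j \<le> N n \<pi> then enat (LEAST k. j \<le> N k \<pi>) else \<infinity>)"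
  have N0: "N 0 \<pi> = 0" for \<pi> by (simp add: N_def)
  have NSuc: "N (Suc k) \<pi> = (if c (Suc k) \<pi> then Suc (N k \<pi>) else N k \<pi>)" for k \<pi>
  proof -
    have "{i\<in>{1..Suc k}. c i \<pi>} = (if c (Suc k) \<pi> then insert (Suc k) {i\<in>{1..k}. c i \<pi>} else {i\<in>{1..k}. c i \<pi>})"
      by (auto simp: le_Suc_eq)
    then show ?thesis by (simp add: N_def)
  qed
  have Nmono: "N i \<pi> \<le> N k \<pi>" if "i \<le> k" for i k \<pi>
    unfolding N_def using that by (intro card_mono) auto
  \<comment> \<open>The range, the stopping property and the exact selection times all follow from
    this inversion of the counting function.\<close>
  have le_iff: "\<tau> j \<pi> \<le> enat k \<longleftrightarrow> j \<le> N k \<pi>" if "k \<le> n" for j k \<pi>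
  proof
    assume "\<tau> j \<pi> \<le> enat k"
    then have "j \<le> N n \<pi>" "(LEAST k. j \<le> N k \<pi>) \<le> k" by (auto simp: \<tau>_def split: if_splits)
    then show "j \<le> N k \<pi>" using LeastI[of "\<lambda>k. j \<le> N k \<pi>" n] Nmono order_trans by metis
  next
    assume "j \<le> N k \<pi>"
    then show "\<tau> j \<pi> \<le> enat k"
      using Nmono[OF that, of \<pi>] Least_le[of "\<lambda>k. j \<le> N k \<pi>" k] by (simp add: \<tau>_def)
  qed
  have range: "\<tau> j \<pi> \<in> enat ` {1..n} \<union> {\<infinity>}" if "j \<ge> 1" for j \<pi>
  proof (cases "\<tau> j \<pi>")
    case (enat k)
    then have "\<tau> j \<pi> \<le> enat n" using le_iff[of n j \<pi>] by (auto simp: \<tau>_def split: if_splits)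
    moreover have "\<not> \<tau> j \<pi> \<le> enat 0" using le_iff[of 0 j \<pi>] N0 that by simp
    ultimately show ?thesis using enat by auto
  qed simp
  have eq_iff: "\<tau> j \<pi> = enat (Suc k) \<longleftrightarrow> c (Suc k) \<pi> \<and> j = Suc (N k \<pi>)" if "Suc k \<le> n" for j k \<pi>
  proof -
    have "\<tau> j \<pi> = enat (Suc k) \<longleftrightarrow> \<tau> j \<pi> \<le> enat (Suc k) \<and> \<not> \<tau> j \<pi> \<le> enat k"
      by (cases "\<tau> j \<pi>") auto
    then show ?thesis using le_iff[of k j \<pi>] le_iff[of "Suc k" j \<pi>] that NSuc[of k \<pi>] by auto
  qed
  have Nprefix: "N k \<pi> = N k \<pi>'" if "\<pi> \<in> perms n" "\<pi>' \<in> perms n" "same_prefix k \<pi> \<pi>'" "k \<le> n" for k \<pi> \<pi>'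
  proof -
    have "c i \<pi> = c i \<pi>'" if "i \<in> {1..k}" for i
      using that \<open>k \<le> n\<close> same_prefix_mono[OF \<open>same_prefix k \<pi> \<pi>'\<close>, of i]
      by (intro adaptedD[OF assms _ \<open>\<pi> \<in> perms n\<close> \<open>\<pi>' \<in> perms n\<close>]) simp_all
    then have "{i\<in>{1..k}. c i \<pi>} = {i\<in>{1..k}. c i \<pi>'}" by blast
    then show ?thesis by (simp add: N_def)
  qed
  have "stopping_time (perm_filtration n) (\<tau> j)" if "j \<ge> 1" for j
    unfolding stopping_time_perm_filtration_iff[OF range[OF that]]
  proof
    fix k assume "k \<in> {1..n}"
    then have k: "k \<le> n" by simp
    show "{\<pi> \<in> perms n. \<tau> j \<pi> \<le> enat k} \<in> sets (perm_filtration n (enat k))"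
    proof (rule perm_filtrationI_prefix[OF _ k])
      fix \<pi> \<pi>' assume "\<pi> \<in> {\<pi> \<in> perms n. \<tau> j \<pi> \<le> enat k}" "\<pi>' \<in> perms n" "same_prefix k \<pi> \<pi>'"
      then show "\<pi>' \<in> {\<pi> \<in> perms n. \<tau> j \<pi> \<le> enat k}"
        using le_iff[OF k, of j] Nprefix[of \<pi> \<pi>' k] k by simp
    qed simp
  qed
  moreover have "\<tau> j \<pi> < \<tau> (Suc j) \<pi> \<or> (\<tau> j \<pi> = \<infinity> \<and> \<tau> (Suc j) \<pi> = \<infinity>)" if j: "j \<ge> 1" for j \<pi>
  proof (cases "\<tau> j \<pi>")
    case (enat k)
    then obtain i where i: "\<tau> j \<pi> = enat (Suc i)" "Suc i \<le> n" using range[OF j, of \<pi>]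
      by (cases k) auto
    then have "\<not> Suc j \<le> N (Suc i) \<pi>" using eq_iff[of i j \<pi>] NSuc[of i \<pi>] by auto
    then show ?thesis using i le_iff[of "Suc i" "Suc j" \<pi>] by simp
  next
    case infinity
    then show ?thesis by (auto simp: \<tau>_def split: if_splits)
  qed
  ultimately have "feasible_strategy n \<tau>"
    using range unfolding feasible_strategy_def by blast
  moreover have "selected_at \<tau> k \<pi> = c k \<pi>" if "k \<in> {1..n}" for k \<pi>
    using that eq_iff[of "k - 1" _ \<pi>] unfolding selected_at_def by (cases k) auto
  ultimately show ?thesis using that by blast
qed

lemma chain_state_cong:
  assumes "\<And>i. 1 \<le> i \<Longrightarrow> i \<le> k \<Longrightarrow> c i \<pi> = c' i \<pi>"
  shows "chain_state c k \<pi> = chain_state c' k \<pi>"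
  using assms by (induction k) auto
subsection \<open>The optimality recursion\<close>

lemma bellman_mono_Suc: "bellman n \<le> bellman (Suc n)"
proof -
  have "real (Suc n) * bellman n = (\<Sum>i\<le>n. bellman n)" by simp
  also have "\<dots> \<le> (\<Sum>i\<le>n. max (bellman n) (1 + bellman i))" by (intro sum_mono) simp
  finally show ?thesis by (simp add: le_divide_eq mult.commute del: of_nat_Suc)
qed

lemma bellman_nonneg: "bellman n \<ge> 0"
  by (induction n) (simp, metis bellman_mono_Suc order_trans)

text \<open>Counted from above, the ranks in \<open>E\<close> run once through the numbers below
  \<open>card E\<close>; in the induction a new least element has all the others above it.\<close>

lemma sum_rank:
  fixes E :: "nat set" and h :: "nat \<Rightarrow> real"
  assumes "finite E"
  shows "(\<Sum>w\<in>E. h (card {u\<in>E. w < u})) = (\<Sum>i<card E. h i)"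
  using assms
proof (induction rule: finite_linorder_min_induct)
  case (insert b A)
  have "b \<notin> A" using insert by auto
  have "{u \<in> insert b A. b < u} = A" using insert by auto
  moreover have "{u \<in> insert b A. w < u} = {u \<in> A. w < u}" if "w \<in> A" for w using insert that by auto
  ultimately show ?case using insert \<open>b \<notin> A\<close> by simp
qed simp

text \<open>The recursion in the form needed for averaging the better of refusing and accepting over
  the useful values.\<close>

lemma sum_max_rank:
  fixes E :: "nat set"
  assumes "finite E"
  shows "(\<Sum>w\<in>E. max (bellman (card E - 1)) (1 + bellman (card {u\<in>E. w < u}))) = real (card E) * bellman (card E)"
proof (cases "card E")
  case (Suc r)
  show ?thesis
    using sum_rank[OF assms, of "\<lambda>i. max (bellman r) (1 + bellman i)"] Suc
    by (simp add: lessThan_Suc_atMost del: of_nat_Suc)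
qed (use assms in simp)

definition remaining :: "nat \<Rightarrow> nat \<Rightarrow> (nat \<Rightarrow> nat) \<Rightarrow> nat set" where
  "remaining n k \<pi> = {1..n} - \<pi> ` {1..k}"

lemma finite_remaining [simp]: "finite (remaining n k \<pi>)"
  by (simp add: remaining_def)

lemma remaining_eq:
  assumes "\<pi> \<in> perms n" "k \<le> n"
  shows "remaining n k \<pi> = \<pi> ` {Suc k..n}"
proof -
  have "\<pi> ` ({1..n} - {1..k}) = \<pi> ` {1..n} - \<pi> ` {1..k}"
    using assms by (intro image_set_diff permutes_inj) (simp add: perms_def)
  moreover have "{1..n} - {1..k} = {Suc k..n}" by auto
  ultimately show ?thesis
    using assms permutes_image[of \<pi> "{1..n}"] by (simp add: remaining_def perms_def)
qed

lemma remaining_prefix: "same_prefix k \<pi> \<pi>' \<Longrightarrow> remaining n k \<pi> = remaining n k \<pi>'"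
  unfolding remaining_def same_prefix_def by (metis image_cong)

lemma sum_perms_compose:
  fixes f :: "(nat \<Rightarrow> nat) \<Rightarrow> real"
  assumes "\<sigma> permutes {1..n}"
  shows "(\<Sum>\<pi>\<in>perms n. f (\<pi> \<circ> \<sigma>)) = (\<Sum>\<pi>\<in>perms n. f \<pi>)"
  unfolding perms_def by (rule sum_permutations_compose_right[OF assms, symmetric])

lemma perms_compose_transpose:
  assumes "\<pi> \<in> perms n" "i \<in> {1..n}" "j \<in> {1..n}"
  shows "\<pi> \<circ> Transposition.transpose i j \<in> perms n"
  using assms permutes_compose[OF permutes_swap_id[OF assms(2,3)], of \<pi>] by (simp add: perms_def)

section \<open>One-step averages of the potential\<close>

definition potential :: "(nat \<Rightarrow> (nat \<Rightarrow> nat) \<Rightarrow> bool) \<Rightarrow> nat \<Rightarrow> nat \<Rightarrow> (nat \<Rightarrow> nat) \<Rightarrow> real" where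
  "potential c n k \<pi> = (case chain_state c k \<pi> of (l, m, a) \<Rightarrow>
     real l + (if a then bellman (card {v \<in> remaining n k \<pi>. m < v}) else 0))"

text \<open>\<open>U\<close> still contains the value \<open>w\<close> on offer, hence the
  \<open>- 1\<close>: refusing \<open>w\<close> leaves one useful value fewer.\<close>

definition greedy :: "nat set \<Rightarrow> nat \<Rightarrow> nat \<Rightarrow> bool" where
  "greedy U m w \<longleftrightarrow> m < w \<and> bellman (card {u\<in>U. m < u} - 1) \<le> 1 + bellman (card {u\<in>U. w < u})"

text \<open>Swapping position \<open>Suc k\<close> with the positions from there on keeps the first
  \<open>k\<close> values and puts each remaining value at \<open>Suc k\<close> exactly once, so the
  sum over \<open>i\<close> becomes a sum over the possible next values.\<close>

lemma step_potential:
  assumes "adapted n c" "\<pi> \<in> perms n" "k < n"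
  shows "(\<Sum>i\<in>{Suc k..n}. potential c n (Suc k) (\<pi> \<circ> Transposition.transpose (Suc k) i)) \<le> real (n - k) * potential c n k \<pi>"
    and "(\<And>\<pi>. \<pi> \<in> perms n \<Longrightarrow> c (Suc k) \<pi> \<longleftrightarrow> greedy (remaining n k \<pi>) (fst (snd (chain_state c k \<pi>))) (\<pi> (Suc k)))
     \<Longrightarrow> snd (snd (chain_state c k \<pi>))
     \<Longrightarrow> (\<Sum>i\<in>{Suc k..n}. potential c n (Suc k) (\<pi> \<circ> Transposition.transpose (Suc k) i)) = real (n - k) * potential c n k \<pi>"
proof -
  obtain l m a where st: "chain_state c k \<pi> = (l, m, a)" by (metis prod_cases3)
  define U where "U = remaining n k \<pi>"
  define E where "E = {u\<in>U. m < u}"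
  define \<pi>' where "\<pi>' = (\<lambda>i. \<pi> \<circ> Transposition.transpose (Suc k) i)"
  \<comment> \<open>The potential after the best decision when \<open>w\<close> is on offer; a value
    not above \<open>m\<close> is best refused.\<close>
  define opt where "opt = (\<lambda>w. real l + (if m < w then max (bellman (card E - 1)) (1 + bellman (card {u\<in>E. w < u})) else bellman (card E)))"
  have fin: "finite U" "finite E" by (auto simp: U_def E_def)
  have inj: "inj_on \<pi> {Suc k..n}"
    using assms(2) permutes_inj_on by (auto simp: perms_def)
  have U: "U = \<pi> ` {Suc k..n}" using assms remaining_eq[of \<pi> n k] by (simp add: U_def)
  then have cardU: "card U = n - k" using card_image[OF inj] by simp
  have EU: "E \<subseteq> U" by (auto simp: E_def)
  have perm: "\<pi>' i \<in> perms n" if "i \<in> {Suc k..n}" for i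
    unfolding \<pi>'_def using that assms by (intro perms_compose_transpose) auto
  have st': "chain_state c k (\<pi>' i) = (l, m, a)" "remaining n k (\<pi>' i) = U" if "i \<in> {Suc k..n}" for i
  proof -
    have pre: "same_prefix k \<pi> (\<pi>' i)"
      using that by (auto simp: same_prefix_def \<pi>'_def Transposition.transpose_def)
    show "chain_state c k (\<pi>' i) = (l, m, a)"
      using chain_state_prefix[OF assms(1,2) perm[OF that] _ pre] assms(3) st by simp
    show "remaining n k (\<pi>' i) = U" using remaining_prefix[OF pre] U_def by simp
  qed
  have val: "\<pi>' i (Suc k) = \<pi> i" for i by (simp add: \<pi>'_def)
  have rem: "remaining n (Suc k) (\<pi>' i) = U - {\<pi> i}" if "i \<in> {Suc k..n}" for i
  proof -
    have "{1..Suc k} = insert (Suc k) {1..k}" by auto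
    then have "remaining n (Suc k) (\<pi>' i) = remaining n k (\<pi>' i) - {\<pi>' i (Suc k)}"
      unfolding remaining_def by auto
    then show ?thesis using st'[OF that] val by simp
  qed
  have pot: "potential c n (Suc k) (\<pi>' i) =
      (let w = \<pi> i in if a then if c (Suc k) (\<pi>' i) then if m < w then real l + 1 + bellman (card {u\<in>E. w < u}) else real l
         else real l + (if m < w then bellman (card E - 1) else bellman (card E))
       else real l)" if "i \<in> {Suc k..n}" for i
  proof -
    have "{v \<in> U - {\<pi> i}. m < v} = E - {\<pi> i}" by (auto simp: E_def)
    moreover have "card (E - {\<pi> i}) = (if m < \<pi> i then card E - 1 else card E)"
      using that fin by (auto simp: E_def U card_Diff_singleton_if)
    moreover have "{v \<in> U - {\<pi> i}. \<pi> i < v} = {u\<in>E. \<pi> i < u}" if "m < \<pi> i"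
      using that by (auto simp: E_def)
    ultimately show ?thesis
      unfolding potential_def using st'[OF that] rem[OF that] val[of i] by (auto simp: Let_def)
  qed
  have sum_opt: "(\<Sum>i\<in>{Suc k..n}. opt (\<pi> i)) = real (n - k) * (real l + bellman (card E))"
  proof -
    have "(\<Sum>i\<in>{Suc k..n}. opt (\<pi> i)) = (\<Sum>w\<in>U. opt w)"
      unfolding U by (simp add: sum.reindex[OF inj])
    also have "\<dots> = (\<Sum>w\<in>E. opt w) + (\<Sum>w\<in>U - E. opt w)"
      using sum.subset_diff[OF EU fin(1), of opt] by simp
    also have "(\<Sum>w\<in>E. opt w) = (\<Sum>w\<in>E. real l + max (bellman (card E - 1)) (1 + bellman (card {u\<in>E. w < u})))"
      by (intro sum.cong) (auto simp: opt_def E_def)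
    also have "\<dots> = real (card E) * (real l + bellman (card E))"
      unfolding sum.distrib sum_max_rank[OF fin(2)] by (simp add: algebra_simps)
    \<comment> \<open>Values outside \<open>E\<close> leave the number of useful values
      unchanged.\<close>
    also have "(\<Sum>w\<in>U - E. opt w) = (\<Sum>w\<in>U - E. real l + bellman (card E))"
      by (intro sum.cong) (auto simp: opt_def E_def)
    also have "\<dots> = (real (card U) - real (card E)) * (real l + bellman (card E))"
      using fin EU by (simp add: card_Diff_subset card_mono of_nat_diff)
    finally show ?thesis by (simp add: cardU algebra_simps)
  qed
  have pot0: "potential c n k \<pi> = real l + (if a then bellman (card E) else 0)"
    by (simp add: potential_def st U_def E_def)
  show "(\<Sum>i\<in>{Suc k..n}. potential c n (Suc k) (\<pi> \<circ> Transposition.transpose (Suc k) i)) \<le> real (n - k) * potential c n k \<pi>"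
  proof (cases a)
    case True
    \<comment> \<open>Breaking the chain leaves only \<open>l\<close>, which is no better than
      refusing since \<open>bellman\<close> is nonnegative.\<close>
    have "(\<Sum>i\<in>{Suc k..n}. potential c n (Suc k) (\<pi>' i)) \<le> (\<Sum>i\<in>{Suc k..n}. opt (\<pi> i))"
      by (intro sum_mono) (auto simp: pot opt_def Let_def True bellman_nonneg)
    then show ?thesis using sum_opt pot0 True by (simp add: \<pi>'_def)
  next
    case False
    have "(\<Sum>i\<in>{Suc k..n}. potential c n (Suc k) (\<pi>' i)) = (\<Sum>i\<in>{Suc k..n}. real l)"
      by (intro sum.cong) (auto simp: pot False)
    then show ?thesis using pot0 False by (simp add: \<pi>'_def)
  qed
  show "(\<Sum>i\<in>{Suc k..n}. potential c n (Suc k) (\<pi> \<circ> Transposition.transpose (Suc k) i)) = real (n - k) * potential c n k \<pi>"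
    if greedy: "\<And>\<pi>. \<pi> \<in> perms n \<Longrightarrow> c (Suc k) \<pi> \<longleftrightarrow> greedy (remaining n k \<pi>) (fst (snd (chain_state c k \<pi>))) (\<pi> (Suc k))"
      and alive: "snd (snd (chain_state c k \<pi>))"
  proof -
    have a: a using alive st by simp
    have "potential c n (Suc k) (\<pi>' i) = opt (\<pi> i)" if i: "i \<in> {Suc k..n}" for i
    proof -
      have "c (Suc k) (\<pi>' i) \<longleftrightarrow> m < \<pi> i \<and> bellman (card E - 1) \<le> 1 + bellman (card {u\<in>U. \<pi> i < u})"
        using greedy[OF perm[OF i]] st'[OF i] val by (simp add: greedy_def E_def)
      moreover have "{u\<in>U. \<pi> i < u} = {u\<in>E. \<pi> i < u}" if "m < \<pi> i"
        using that by (auto simp: E_def)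
      ultimately show ?thesis by (auto simp: pot[OF i] opt_def Let_def a)
    qed
    then have "(\<Sum>i\<in>{Suc k..n}. potential c n (Suc k) (\<pi>' i)) = (\<Sum>i\<in>{Suc k..n}. opt (\<pi> i))" by simp
    then show ?thesis using sum_opt pot0 a by (simp add: \<pi>'_def)
  qed
qed

text \<open>Right composition with a transposition preserves the uniform distribution, so the average over
  the swaps of \<open>k + 1\<close> with later positions plays the role of the conditional expectation.\<close>

lemma sum_potential_swap:
  assumes "k < n"
  shows "(\<Sum>\<pi>\<in>perms n. \<Sum>i\<in>{Suc k..n}. potential c n (Suc k) (\<pi> \<circ> Transposition.transpose (Suc k) i)) =
    real (n - k) * (\<Sum>\<pi>\<in>perms n. potential c n (Suc k) \<pi>)"
proof -
  have "(\<Sum>\<pi>\<in>perms n. \<Sum>i\<in>{Suc k..n}. potential c n (Suc k) (\<pi> \<circ> Transposition.transpose (Suc k) i)) =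
    (\<Sum>i\<in>{Suc k..n}. \<Sum>\<pi>\<in>perms n. potential c n (Suc k) (\<pi> \<circ> Transposition.transpose (Suc k) i))"
    by (rule sum.swap)
  also have "\<dots> = (\<Sum>i\<in>{Suc k..n}. \<Sum>\<pi>\<in>perms n. potential c n (Suc k) \<pi>)"
    using assms by (intro sum.cong sum_perms_compose permutes_swap_id refl) auto
  finally show ?thesis by simp
qed

lemma potential_0: "potential c n 0 \<pi> = bellman n"
proof -
  have "{v. Suc 0 \<le> v \<and> v \<le> n \<and> 0 < v} = {1..n}" by auto
  then show ?thesis by (simp add: potential_def remaining_def)
qed

text \<open>At time \<open>n\<close> no values remain, and \<open>bellman 0 = 0\<close>.\<close>

lemma potential_n:
  assumes "\<pi> \<in> perms n"
  shows "potential c n n \<pi> = real (fst (chain_state c n \<pi>))"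
  using assms remaining_eq[of \<pi> n n] by (auto simp: potential_def split: prod.splits)

text \<open>The total potential starts at the right-hand side, cannot grow in any step, and ends as
  the total length; the factor \<open>n - k\<close> cancels because \<open>k < n\<close>.\<close>

lemma sum_chain_le:
  assumes "adapted n c"
  shows "(\<Sum>\<pi>\<in>perms n. real (fst (chain_state c n \<pi>))) \<le> real (card (perms n)) * bellman n"
proof -
  have "(\<Sum>\<pi>\<in>perms n. potential c n k \<pi>) \<le> real (card (perms n)) * bellman n" if "k \<le> n" for k
    using that
  proof (induction k)
    case (Suc k)
    have "real (n - k) * (\<Sum>\<pi>\<in>perms n. potential c n (Suc k) \<pi>) \<le> (\<Sum>\<pi>\<in>perms n. real (n - k) * potential c n k \<pi>)"
      unfolding sum_potential_swap[OF Suc_le_lessD[OF Suc.prems], symmetric]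
      using Suc.prems by (intro sum_mono step_potential(1)[OF assms]) auto
    also have "\<dots> = real (n - k) * (\<Sum>\<pi>\<in>perms n. potential c n k \<pi>)" by (simp add: sum_distrib_left)
    finally show ?case using Suc by (simp add: mult_le_cancel_left)
  qed (simp add: potential_0)
  from this[of n] show ?thesis by (simp add: potential_n)
qed

section \<open>The greedy rule and its optimality\<close>

text \<open>Computed independently of \<open>chain_state\<close>, which takes the rule as an
  argument; defining the rule through its own chain state would be circular.\<close>

fun greedy_last :: "nat \<Rightarrow> nat \<Rightarrow> (nat \<Rightarrow> nat) \<Rightarrow> nat" where
  "greedy_last n 0 \<pi> = 0"
| "greedy_last n (Suc k) \<pi> = (if greedy (remaining n k \<pi>) (greedy_last n k \<pi>) (\<pi> (Suc k))
     then \<pi> (Suc k) else greedy_last n k \<pi>)"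

definition greedy_rule :: "nat \<Rightarrow> nat \<Rightarrow> (nat \<Rightarrow> nat) \<Rightarrow> bool" where
  "greedy_rule n k \<pi> \<longleftrightarrow> greedy (remaining n (k - 1) \<pi>) (greedy_last n (k - 1) \<pi>) (\<pi> k)"

text \<open>Only values above the last selected one are accepted, so the chain never breaks.\<close>

lemma chain_state_greedy_rule: "snd (chain_state (greedy_rule n) k \<pi>) = (greedy_last n k \<pi>, True)"
proof (induction k)
  case (Suc k)
  obtain l m a where st: "chain_state (greedy_rule n) k \<pi> = (l, m, a)" by (metis prod_cases3)
  then have "m = greedy_last n k \<pi>" a using Suc by auto
  moreover have "greedy_rule n (Suc k) \<pi> = greedy (remaining n k \<pi>) (greedy_last n k \<pi>) (\<pi> (Suc k))"
    by (simp add: greedy_rule_def)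
  moreover have "m < \<pi> (Suc k)" if "greedy (remaining n k \<pi>) m (\<pi> (Suc k))"
    using that by (simp add: greedy_def)
  ultimately show ?case using st by simp
qed simp

lemma greedy_last_prefix: "same_prefix k \<pi> \<pi>' \<Longrightarrow> greedy_last n k \<pi> = greedy_last n k \<pi>'"
proof (induction k)
  case (Suc k)
  have "same_prefix k \<pi> \<pi>'" using Suc.prems by (rule same_prefix_mono) simp
  moreover have "\<pi> (Suc k) = \<pi>' (Suc k)" using Suc.prems by (simp add: same_prefix_def)
  ultimately show ?case using Suc.IH remaining_prefix[of k \<pi> \<pi>' n] by simp
qed simp

lemma adapted_greedy_rule: "adapted n (greedy_rule n)"
  unfolding adapted_def
proof (intro ballI impI)
  fix k \<pi> \<pi>' assume "k \<in> {1..n}" and pre: "same_prefix k \<pi> \<pi>'"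
  then have "\<pi> k = \<pi>' k" by (simp add: same_prefix_def)
  moreover have "same_prefix (k - 1) \<pi> \<pi>'" using pre by (rule same_prefix_mono) simp
  ultimately show "greedy_rule n k \<pi> = greedy_rule n k \<pi>'"
    using remaining_prefix greedy_last_prefix unfolding greedy_rule_def by metis
qed

text \<open>The chain stays alive and every decision attains the maximum, so each step preserves the
  total potential.\<close>

lemma sum_chain_greedy:
  "(\<Sum>\<pi>\<in>perms n. real (fst (chain_state (greedy_rule n) n \<pi>))) = real (card (perms n)) * bellman n"
proof -
  let ?c = "greedy_rule n"
  have "(\<Sum>\<pi>\<in>perms n. potential ?c n k \<pi>) = real (card (perms n)) * bellman n" if "k \<le> n" for k
    using that
  proof (induction k)
    case (Suc k)
    have "real (n - k) * (\<Sum>\<pi>\<in>perms n. potential ?c n (Suc k) \<pi>) = (\<Sum>\<pi>\<in>perms n. real (n - k) * potential ?c n k \<pi>)"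
      unfolding sum_potential_swap[OF Suc_le_lessD[OF Suc.prems], symmetric]
      using Suc.prems
      by (intro sum.cong refl step_potential(2)[OF adapted_greedy_rule])
        (auto simp: chain_state_greedy_rule greedy_rule_def)
    also have "\<dots> = real (n - k) * (\<Sum>\<pi>\<in>perms n. potential ?c n k \<pi>)" by (simp add: sum_distrib_left)
    finally show ?case using Suc by simp
  qed (simp add: potential_0)
  from this[of n] show ?thesis by (simp add: potential_n)
qed

text \<open>The upper bound applies to the selection times of any strategy, and the greedy rule,
  realised by stopping times, attains it.\<close>

lemma optimal_mean_length_eq_bellman: "optimal_mean_length n = bellman n"
proof -
  let ?E = "\<lambda>\<tau>. \<integral>\<pi>. real (selected_length n \<tau> \<pi>) \<partial>uniform_count_measure (perms n)"
  have card: "real (card (perms n)) > 0"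
    using finite_perms perms_nonempty by (simp add: card_gt_0_iff)
  have E: "?E \<tau> = (\<Sum>\<pi>\<in>perms n. real (fst (chain_state (selected_at \<tau>) n \<pi>))) / real (card (perms n))"
    if "feasible_strategy n \<tau>" for \<tau>
    using that by (simp add: integral_uniform_count_measure[OF finite_perms] selected_length_eq_chain_state)
  have "?E \<tau> \<le> bellman n" if "feasible_strategy n \<tau>" for \<tau>
    unfolding E[OF that] using sum_chain_le[OF adapted_selected_at[OF that]] card
    by (simp add: divide_le_eq mult.commute)
  then have "optimal_mean_length n \<le> bellman n"
    unfolding optimal_mean_length_def using feasible_strategy_never by (intro cSUP_least) auto
  moreover obtain \<tau> where \<tau>: "feasible_strategy n \<tau>"
    "\<And>\<pi> k. \<pi> \<in> perms n \<Longrightarrow> k \<in> {1..n} \<Longrightarrow> selected_at \<tau> k \<pi> = greedy_rule n k \<pi>"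
    using obtain_strategy[OF adapted_greedy_rule] by metis
  have "chain_state (selected_at \<tau>) n \<pi> = chain_state (greedy_rule n) n \<pi>" if "\<pi> \<in> perms n" for \<pi>
    using \<tau>(2)[OF that] by (intro chain_state_cong) auto
  then have "bellman n = ?E \<tau>"
    unfolding E[OF \<tau>(1)] using card sum_chain_greedy[of n] by simp
  then have "bellman n \<le> optimal_mean_length n"
    unfolding optimal_mean_length_def using \<tau>(1) bdd_above_mean_length by (auto intro!: cSUP_upper2)
  ultimately show ?thesis by simp
qed

theorem theorem1:
  shows "\<exists>C::real. \<forall>n::nat. n \<ge> 1 \<longrightarrow>
    \<bar>optimal_mean_length n - sqrt (2 * real n) - ln (real n) / 6\<bar> \<le> C"
  using bellman_asymp by (simp add: optimal_mean_length_eq_bellman)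

end
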